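(* Let $f$ be $(\delta_f,L_f)$-approximately smooth with components $(\bar f,\bar g)$, let $\|x-y\|\le D$ for all $x,y\in\operatorname{dom}\psi$, and let $\hat g$ be an unbiased stochastic oracle for $\bar g$ for which there exist $\delta_{\hat g},L_{\hat g}\ge0$ such that $\mathrm{Var}_{\hat g}(x,y)\le2L_{\hat g}[\beta(x,y)+\delta_{\hat g}]$ for all $x,y\in\mathbb R^d$. Let $\sigma_*^2:=\mathrm{Var}_{\hat g}(x^* )$. Let $(x_k)$ be the points generated by UniversalFastSgd (defined in the context) from a point $x_0\in\operatorname{dom}\psi$ with diameter parameter $D$ and a stepsize update rule $M_+(\cdot)$ satisfying the requirement (R) of the context with constants $c_1,c_2,c_3,c_4>0$. Then, for any $k\ge1$, $$\mathbb E[F(x_k)]-F^*\le\frac{4c_2c_4L_fD^2}{k(k+1)}+\frac{24c_1c_4L_{\hat g}D^2}{k+1}+4\sigma_*D\sqrt{\frac{2c_1c_4}{k}}+\frac{c_3}{3}(k+2)\delta_f+\frac43\delta_{\hat g}.$$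
   Context: Space: $\mathbb R^d$ with standard inner product $\langle\cdot,\cdot\rangle$, norm $\|x\|=\langle Bx,x\rangle^{1/2}$ ($B$ a fixed positive definite matrix), dual norm $\|s\|_*=\max_{\|x\|=1}\langle s,x\rangle=\langle s,B^{-1}s\rangle^{1/2}$. $[t]_+=\max\{t,0\}$. All expectations are assumed well defined. Problem: $F^*=\min_{x\in\operatorname{dom}\psi}[F(x):=f(x)+\psi(x)]$, where $f:\mathbb R^d\to\mathbb R$ is convex, $\psi:\mathbb R^d\to\mathbb R\cup\{+\infty\}$ is proper closed convex, $\operatorname{dom}\psi=\{x:\psi(x)<+\infty\}$; a solution $x^*$ is assumed to exist. Approximate smoothness: $f$ is $(\delta_f,L_f)$-approximately smooth ($\delta_f,L_f\ge0$) with components $\bar f:\mathbb R^d\to\mathbb R$, $\bar g:\mathbb R^d\to\mathbb R^d$ if $\beta(x,y):=f(y)-\bar f(x)-\langle\bar g(x),y-x\rangle$ satisfies $0\le\beta(x,y)\le\frac{L_f}{2}\|x-y\|^2+\delta_f$ for all $x,y\in\mathbb R^d$. Stochastic oracle: $\hat g=(g,\xi)$ is a random variable $\xi$ with a mapping $g$; a query at $x$ returns $g(x,\xi)$ with a fresh independent copy of $\xi$. It is unbiased for $\bar g$ if $\mathbb E_\xi[g(x,\xi)]=\bar g(x)$ for all $x$. $\mathrm{Var}_{\hat g}(x)=\mathbb E_\xi[\|g(x,\xi)-\bar g(x)\|_*^2]$ and $\mathrm{Var}_{\hat g}(x,y)=\mathbb E_\xi[\|[g(x,\xi)-g(y,\xi)]-[\bar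 g(x)-\bar g(y)]\|_*^2]$. Proximal map: $\mathrm{Prox}_\psi(x,g,M)=\operatorname{argmin}_{y\in\operatorname{dom}\psi}\{\langle g,y\rangle+\psi(y)+\frac M2\|y-x\|^2\}$, $M\ge 0$ (if $M=0$, any minimizer may be chosen). Requirement (R) on the stepsize update rule $M_+$ with constants $c_1,\dots,c_4>0$: let $\Omega>0$ be a constant, $x\in\operatorname{dom}\psi$ a (possibly random) current point, $\hat g_x$ the output of a query of $\hat g$ at $x$, $M\ge0$ a coefficient and $\hat x_+\in\operatorname{dom}\psi$ a random point (both possibly dependent on $\hat g_x$), and $\hat g_{x_+}$ the output of a query of $\hat g$ at $\hat x_+$ with fresh randomness independent of everything else. Then $\hat M_+=M_+(M,\Omega,x,\hat x_+,\hat g_x,\hat g_{x_+})$ satisfies $\hat M_+\ge M$ and, for every constant $\bar M>c_2L_f$, $$\mathbb E[\hat\Delta(\hat M_+)+(\hat M_+-M)\Omega+\beta(\hat x_+,x)]\le\frac{c_1}{\bar M-c_2L_f}\mathbb E[\mathrm{Var}_{\hat g}(\hat x_+)+\mathrm{Var}_{\hat g}(x)]+c_3\delta_f+c_4\mathbb E\{[\min\{\hat M_+,\bar M\}-M]_+\Omega\},$$ where $\hat\Delta(\hat M_+)=\beta(x,\hat x_+)+\langle\bar g(x)-\hat g_x,\hat x_+-x\rangle-\frac{\hat M_+}{2}\|\hat x_+-x\|^2$ and the expectation is over all randomness. (Main example: $\hat M_+=\sqrt{M^2+\frac1\Omega\|\hat g_{x_+}-\hat g_x\|_*^2}$, with $c_1=\frac52,c_2=4,c_3=6,c_4=2$.)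 UniversalFastSgd with oracle $\hat g$, inputs $x_0\in\operatorname{dom}\psi$, $D$: set $v_0=x_0$, $M_0=A_0=0$. For $k=0,1,\dots$: $a_{k+1}=\frac12(k+1)$, $A_{k+1}=A_k+a_{k+1}$; $y_k=\frac{A_k}{A_{k+1}}x_k+\frac{a_{k+1}}{A_{k+1}}v_k$; query $g_{y_k}$ from $\hat g$ at $y_k$; $v_{k+1}=\mathrm{Prox}_\psi(v_k,g_{y_k},\frac{M_k}{a_{k+1}})$; $x_{k+1}=\frac{A_k}{A_{k+1}}x_k+\frac{a_{k+1}}{A_{k+1}}v_{k+1}$; query $g_{x_{k+1}}$ from $\hat g$ at $x_{k+1}$; $M_{k+1}=\frac{a_{k+1}^2}{A_{k+1}}M_+\bigl(\frac{A_{k+1}}{a_{k+1}^2}M_k,\frac{a_{k+1}^2}{A_{k+1}^2}D^2,y_k,x_{k+1},g_{y_k},g_{x_{k+1}}\bigr)$. *)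

theory Defs
  imports "HOL-Probability.Probability"
begin

subsection \<open>Norms induced by a positive definite matrix\<close>

definition positive_definite :: "real ^ 'n ^ 'n \<Rightarrow> bool" where
  "positive_definite B \<longleftrightarrow> transpose B = B \<and> (\<forall>x. x \<noteq> 0 \<longrightarrow> 0 < (B *v x) \<bullet> x)"

definition primal_norm :: "real ^ 'n ^ 'n \<Rightarrow> real ^ 'n \<Rightarrow> real" where
  "primal_norm B x = sqrt ((B *v x) \<bullet> x)"

definition dual_norm :: "real ^ 'n ^ 'n \<Rightarrow> real ^ 'n \<Rightarrow> real" where
  "dual_norm B s = (SUP x \<in> {x. primal_norm B x = 1}. s \<bullet> x)"

subsection \<open>The composite problem\<close>

definition eff_dom :: "('a \<Rightarrow> ereal) \<Rightarrow> 'a set" where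
  "eff_dom \<psi> = {x. \<psi> x < \<infinity>}"

definition ereal_epigraph :: "('a \<Rightarrow> ereal) \<Rightarrow> ('a \<times> real) set" where
  "ereal_epigraph \<psi> = {(x, t). \<psi> x \<le> ereal t}"

definition proper_closed_convex :: "('a::real_normed_vector \<Rightarrow> ereal) \<Rightarrow> bool" where
  "proper_closed_convex \<psi> \<longleftrightarrow>
     (\<forall>x. \<psi> x \<noteq> -\<infinity>) \<and> eff_dom \<psi> \<noteq> {} \<and>
     closed (ereal_epigraph \<psi>) \<and> convex (ereal_epigraph \<psi>)"

definition objective :: "('a \<Rightarrow> real) \<Rightarrow> ('a \<Rightarrow> ereal) \<Rightarrow> 'a \<Rightarrow> ereal" where
  "objective f \<psi> x = ereal (f x) + \<psi> x"

definition optimal_value :: "('a \<Rightarrow> real) \<Rightarrow> ('a \<Rightarrow> ereal) \<Rightarrow> ereal" where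
  "optimal_value f \<psi> = (INF x \<in> eff_dom \<psi>. objective f \<psi> x)"

definition is_solution :: "('a \<Rightarrow> real) \<Rightarrow> ('a \<Rightarrow> ereal) \<Rightarrow> 'a \<Rightarrow> bool" where
  "is_solution f \<psi> x \<longleftrightarrow> is_arg_min (objective f \<psi>) (\<lambda>y. y \<in> eff_dom \<psi>) x"

text \<open>The set of all minimizers: it may have several elements when \<open>M = 0\<close>.\<close>

definition Prox ::
  "real ^ 'n ^ 'n \<Rightarrow> (real ^ 'n \<Rightarrow> ereal) \<Rightarrow> real ^ 'n \<Rightarrow> real ^ 'n \<Rightarrow> real \<Rightarrow> (real ^ 'n) set" where
  "Prox B \<psi> x g M =
     {z. is_arg_min (\<lambda>y. ereal (g \<bullet> y) + \<psi> y + ereal (M / 2 * (primal_norm B (y - x))\<^sup>2))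
           (\<lambda>y. y \<in> eff_dom \<psi>) z}"

subsection \<open>Approximate smoothness\<close>

definition lin_error ::
  "('a::real_inner \<Rightarrow> real) \<Rightarrow> ('a \<Rightarrow> real) \<Rightarrow> ('a \<Rightarrow> 'a) \<Rightarrow> 'a \<Rightarrow> 'a \<Rightarrow> real" where
  "lin_error f fbar gbar x y = f y - fbar x - gbar x \<bullet> (y - x)"

definition approx_smooth ::
  "real ^ 'n ^ 'n \<Rightarrow> (real ^ 'n \<Rightarrow> real) \<Rightarrow> (real ^ 'n \<Rightarrow> real) \<Rightarrow> (real ^ 'n \<Rightarrow> real ^ 'n) \<Rightarrow>
   real \<Rightarrow> real \<Rightarrow> bool" where
  "approx_smooth B f fbar gbar \<delta> L \<longleftrightarrow> 0 \<le> \<delta> \<and> 0 \<le> L \<and>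
     (\<forall>x y. 0 \<le> lin_error f fbar gbar x y \<and>
            lin_error f fbar gbar x y \<le> L / 2 * (primal_norm B (x - y))\<^sup>2 + \<delta>)"

subsection \<open>Stochastic oracles\<close>

text \<open>An oracle is a map \<open>g\<close> together with the distribution \<open>\<Xi>\<close> of its random argument.
  The finiteness of the variances is part of the standing convention that all expectations are
  well defined; it makes the Bochner integrals below meaningful.\<close>

definition stochastic_oracle :: "'s measure \<Rightarrow> (real ^ 'n \<Rightarrow> 's \<Rightarrow> real ^ 'n) \<Rightarrow> bool" where
  "stochastic_oracle \<Xi> g \<longleftrightarrow> prob_space \<Xi> \<and> (\<lambda>(x, s). g x s) \<in> borel_measurable (borel \<Otimes>\<^sub>M \<Xi>)"

definition unbiased_oracle ::
  "'s measure \<Rightarrow> (real ^ 'n \<Rightarrow> 's \<Rightarrow> real ^ 'n) \<Rightarrow> (real ^ 'n \<Rightarrow> real ^ 'n) \<Rightarrow> bool" where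
  "unbiased_oracle \<Xi> g gbar \<longleftrightarrow> (\<forall>x. integrable \<Xi> (g x) \<and> (\<integral>s. g x s \<partial>\<Xi>) = gbar x)"

definition finite_variance ::
  "real ^ 'n ^ 'n \<Rightarrow> 's measure \<Rightarrow> (real ^ 'n \<Rightarrow> 's \<Rightarrow> real ^ 'n) \<Rightarrow> (real ^ 'n \<Rightarrow> real ^ 'n) \<Rightarrow> bool" where
  "finite_variance B \<Xi> g gbar \<longleftrightarrow> (\<forall>x. integrable \<Xi> (\<lambda>s. (dual_norm B (g x s - gbar x))\<^sup>2))"

definition Var ::
  "real ^ 'n ^ 'n \<Rightarrow> 's measure \<Rightarrow> (real ^ 'n \<Rightarrow> 's \<Rightarrow> real ^ 'n) \<Rightarrow> (real ^ 'n \<Rightarrow> real ^ 'n) \<Rightarrow>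
   real ^ 'n \<Rightarrow> real" where
  "Var B \<Xi> g gbar x = (\<integral>s. (dual_norm B (g x s - gbar x))\<^sup>2 \<partial>\<Xi>)"

definition Var2 ::
  "real ^ 'n ^ 'n \<Rightarrow> 's measure \<Rightarrow> (real ^ 'n \<Rightarrow> 's \<Rightarrow> real ^ 'n) \<Rightarrow> (real ^ 'n \<Rightarrow> real ^ 'n) \<Rightarrow>
   real ^ 'n \<Rightarrow> real ^ 'n \<Rightarrow> real" where
  "Var2 B \<Xi> g gbar x y = (\<integral>s. (dual_norm B ((g x s - g y s) - (gbar x - gbar y)))\<^sup>2 \<partial>\<Xi>)"

text \<open>\<open>\<zeta>\<close> is a fresh copy of the random argument of the oracle, relative to the information
  (sub-\<open>\<sigma>\<close>-algebra) \<open>H\<close> available on the probability space \<open>P\<close> before the query.\<close>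

definition fresh_copy ::
  "'w measure \<Rightarrow> 's measure \<Rightarrow> 'w measure \<Rightarrow> ('w \<Rightarrow> 's) \<Rightarrow> bool" where
  "fresh_copy P \<Xi> H \<zeta> \<longleftrightarrow>
     \<zeta> \<in> measurable P \<Xi> \<and> distr P \<Xi> \<zeta> = \<Xi> \<and>
     prob_space.indep_set P (sets (vimage_algebra (space P) \<zeta> \<Xi>)) (sets H)"

subsection \<open>The requirement on the stepsize update rule\<close>

definition Delta_hat ::
  "real ^ 'n ^ 'n \<Rightarrow> (real ^ 'n \<Rightarrow> real) \<Rightarrow> (real ^ 'n \<Rightarrow> real) \<Rightarrow> (real ^ 'n \<Rightarrow> real ^ 'n) \<Rightarrow>
   real ^ 'n \<Rightarrow> real ^ 'n \<Rightarrow> real ^ 'n \<Rightarrow> real \<Rightarrow> real" where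
  "Delta_hat B f fbar gbar x xp gx M =
     lin_error f fbar gbar x xp + (gbar x - gx) \<bullet> (xp - x) - M / 2 * (primal_norm B (xp - x))\<^sup>2"

text \<open>The random quantities live on the probability space \<open>P\<close>.  \<open>H0\<close> and \<open>H1\<close> are the information
  available before the query at \<open>x\<close> and before the query at \<open>xp\<close>; \<open>\<zeta>\<close> and \<open>\<zeta>'\<close> are the random
  arguments of the two queries.

  The inequality is the one between extended-real expectations.  If the variance term on the right
  is integrable, the right-hand side is finite, because the last term is bounded by \<open>c4 * Mbar * \<Omega>\<close>
  (otherwise it is infinite and there is nothing to state).  The expectation of \<open>X\<close> on the left is
  well defined and not \<open>-\<infinity>\<close> iff \<open>X\<close> is measurable with integrable negative part; that it is bounded by
  a finite right-hand side then says that \<open>X\<close> is integrable and that the inequality holds between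
  the Bochner integrals.\<close>

definition stepsize_requirement ::
  "'w measure \<Rightarrow> 's measure \<Rightarrow> (real ^ 'n \<Rightarrow> 's \<Rightarrow> real ^ 'n) \<Rightarrow> real ^ 'n ^ 'n \<Rightarrow>
   (real ^ 'n \<Rightarrow> real) \<Rightarrow> (real ^ 'n \<Rightarrow> real) \<Rightarrow> (real ^ 'n \<Rightarrow> real ^ 'n) \<Rightarrow> (real ^ 'n \<Rightarrow> ereal) \<Rightarrow>
   real \<Rightarrow> real \<Rightarrow> real \<Rightarrow> real \<Rightarrow> real \<Rightarrow> real \<Rightarrow>
   (real \<Rightarrow> real \<Rightarrow> real ^ 'n \<Rightarrow> real ^ 'n \<Rightarrow> real ^ 'n \<Rightarrow> real ^ 'n \<Rightarrow> real) \<Rightarrow> bool" where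
  "stepsize_requirement P \<Xi> g B f fbar gbar \<psi> \<delta> L c1 c2 c3 c4 Mplus \<longleftrightarrow>
    (\<forall>\<Omega> H0 H1 x \<zeta> M xp \<zeta>'.
      0 < \<Omega> \<longrightarrow>
      subalgebra P H1 \<longrightarrow> subalgebra H1 H0 \<longrightarrow>
      x \<in> borel_measurable H0 \<longrightarrow> (\<forall>\<omega>\<in>space P. x \<omega> \<in> eff_dom \<psi>) \<longrightarrow>
      fresh_copy P \<Xi> H0 \<zeta> \<longrightarrow> \<zeta> \<in> measurable H1 \<Xi> \<longrightarrow>
      M \<in> borel_measurable H1 \<longrightarrow> (\<forall>\<omega>\<in>space P. 0 \<le> M \<omega>) \<longrightarrow>
      xp \<in> borel_measurable H1 \<longrightarrow> (\<forall>\<omega>\<in>space P. xp \<omega> \<in> eff_dom \<psi>) \<longrightarrow>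
      fresh_copy P \<Xi> H1 \<zeta>' \<longrightarrow>
      (let gx = (\<lambda>\<omega>. g (x \<omega>) (\<zeta> \<omega>));
           gxp = (\<lambda>\<omega>. g (xp \<omega>) (\<zeta>' \<omega>));
           Mhat = (\<lambda>\<omega>. Mplus (M \<omega>) \<Omega> (x \<omega>) (xp \<omega>) (gx \<omega>) (gxp \<omega>));
           X = (\<lambda>\<omega>. Delta_hat B f fbar gbar (x \<omega>) (xp \<omega>) (gx \<omega>) (Mhat \<omega>)
                     + (Mhat \<omega> - M \<omega>) * \<Omega> + lin_error f fbar gbar (xp \<omega>) (x \<omega>));
           V = (\<lambda>\<omega>. Var B \<Xi> g gbar (xp \<omega>) + Var B \<Xi> g gbar (x \<omega>))
       in (\<forall>\<omega>\<in>space P. M \<omega> \<le> Mhat \<omega>) \<and>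
          (\<forall>Mbar > c2 * L.
             Mhat \<in> borel_measurable P \<longrightarrow>
             X \<in> borel_measurable P \<longrightarrow> integrable P (\<lambda>\<omega>. max 0 (- X \<omega>)) \<longrightarrow>
             integrable P V \<longrightarrow>
             integrable P X \<and>
             (\<integral>\<omega>. X \<omega> \<partial>P)
               \<le> c1 / (Mbar - c2 * L) * (\<integral>\<omega>. V \<omega> \<partial>P) + c3 * \<delta>
                 + c4 * (\<integral>\<omega>. max 0 (min (Mhat \<omega>) Mbar - M \<omega>) * \<Omega> \<partial>P))))"

subsection \<open>The algorithm\<close>

definition step_a :: "nat \<Rightarrow> real" where
  "step_a k = real k / 2"

definition step_A :: "nat \<Rightarrow> real" where
  "step_A k = (\<Sum>i=1..k. step_a i)"

text \<open>The predicate describes a run of the method on the probability space \<open>P\<close>, started at \<open>x0\<close>.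
  The filtration \<open>H\<close> records the information available before the successive oracle queries: query
  \<open>2 * k\<close> is made at \<open>y k\<close> and query \<open>2 * k + 1\<close> at \<open>x (Suc k)\<close>, with random arguments
  \<open>\<zeta> (2 * k)\<close> and \<open>\<zeta> (2 * k + 1)\<close>.  Since \<open>v (Suc k)\<close> may be an arbitrary element of a
  non-singleton \<open>Prox\<close> set, one has to require that it is a random variable and that it is chosen
  before the next query.\<close>

definition universal_fast_sgd ::
  "'w measure \<Rightarrow> 's measure \<Rightarrow> (real ^ 'n \<Rightarrow> 's \<Rightarrow> real ^ 'n) \<Rightarrow> real ^ 'n ^ 'n \<Rightarrow>
   (real ^ 'n \<Rightarrow> ereal) \<Rightarrow> real \<Rightarrow>
   (real \<Rightarrow> real \<Rightarrow> real ^ 'n \<Rightarrow> real ^ 'n \<Rightarrow> real ^ 'n \<Rightarrow> real ^ 'n \<Rightarrow> real) \<Rightarrow> real ^ 'n \<Rightarrow>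
   (nat \<Rightarrow> 'w measure) \<Rightarrow> (nat \<Rightarrow> 'w \<Rightarrow> 's) \<Rightarrow>
   (nat \<Rightarrow> 'w \<Rightarrow> real ^ 'n) \<Rightarrow> (nat \<Rightarrow> 'w \<Rightarrow> real ^ 'n) \<Rightarrow> (nat \<Rightarrow> 'w \<Rightarrow> real ^ 'n) \<Rightarrow>
   (nat \<Rightarrow> 'w \<Rightarrow> real) \<Rightarrow> bool" where
  "universal_fast_sgd P \<Xi> g B \<psi> D Mplus x0 H \<zeta> x v y M \<longleftrightarrow>
     filtration (space P) H \<and> (\<forall>n. subalgebra P (H n)) \<and>
     (\<forall>n. fresh_copy P \<Xi> (H n) (\<zeta> n) \<and> \<zeta> n \<in> measurable (H (Suc n)) \<Xi>) \<and>
     (\<forall>k. v (Suc k) \<in> borel_measurable (H (2 * k + 1))) \<and>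
     (\<forall>k. M (Suc k) \<in> borel_measurable (H (2 * k + 2))) \<and>
     (\<forall>\<omega>\<in>space P. x 0 \<omega> = x0 \<and> v 0 \<omega> = x0 \<and> M 0 \<omega> = 0) \<and>
     (\<forall>\<omega>\<in>space P. \<forall>k.
        let a = step_a (Suc k); A = step_A k; A' = step_A (Suc k);
            gy = g (y k \<omega>) (\<zeta> (2 * k) \<omega>);
            gx = g (x (Suc k) \<omega>) (\<zeta> (2 * k + 1) \<omega>)
        in y k \<omega> = (A / A') *\<^sub>R x k \<omega> + (a / A') *\<^sub>R v k \<omega> \<and>
           v (Suc k) \<omega> \<in> Prox B \<psi> (v k \<omega>) gy (M k \<omega> / a) \<and>
           x (Suc k) \<omega> = (A / A') *\<^sub>R x k \<omega> + (a / A') *\<^sub>R v (Suc k) \<omega> \<and>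
           M (Suc k) \<omega> =
             a\<^sup>2 / A' * Mplus (A' / a\<^sup>2 * M k \<omega>) (a\<^sup>2 / A'\<^sup>2 * D\<^sup>2) (y k \<omega>) (x (Suc k) \<omega>) gy gx)"

end

theory Submission
  imports Defs
begin

text \<open>
  The potential \<open>A\<^sub>k (F (x\<^sub>k) - F\<^sup>*) + M\<^sub>k / 2 * \<parallel>v\<^sub>k - x\<^sup>*\<parallel>\<^sup>2\<close> satisfies a pathwise recursion whose error
  is a mean-zero noise term plus the quantity bounded by the stepsize requirement; besides, each
  step gains \<open>a\<^sub>k\<^sub>+\<^sub>1 \<beta> (y\<^sub>k, x\<^sup>*) + A\<^sub>k\<^sub>+\<^sub>1 \<beta> (x\<^sub>k\<^sub>+\<^sub>1, y\<^sub>k)\<close>. Bounding both variances by way of the one at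
  \<open>x\<^sup>*\<close> costs multiples of these two terms, which the gain pays for once the cap in the requirement
  exceeds \<open>c\<^sub>2 L\<^sub>f\<close> by enough. With caps proportional to \<open>A\<^sub>k\<^sub>+\<^sub>1 / a\<^sub>k\<^sub>+\<^sub>1\<^sup>2\<close> the capped stepsize increments
  telescope, and the remaining excess of the cap is optimised at the end.

  Integrability comes from the same estimates: variances and \<open>\<beta>\<close> are bounded on the bounded
  domain, the requirement turns a lower bound of its left-hand side by \<open>M\<^sub>k\<^sub>+\<^sub>1\<close> into integrability of
  \<open>M\<^sub>k\<^sub>+\<^sub>1\<close>, and the recursion then dominates \<open>F (x\<^sub>k\<^sub>+\<^sub>1) - F\<^sup>* \<ge> 0\<close>.
\<close>

subsection \<open>Primal and dual norms\<close>

lemma matrix_inner_commute: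
  assumes "positive_definite B"
  shows "(B *v x) \<bullet> y = (B *v y) \<bullet> x"
  by (metis assms dot_lmul_matrix inner_commute positive_definite_def transpose_matrix_vector)

lemma matrix_inner_nonneg:
  assumes "positive_definite B"
  shows "0 \<le> (B *v x) \<bullet> x"
  using assms by (cases "x = 0") (auto simp: positive_definite_def less_imp_le)

lemma primal_norm_nonneg [simp]: "positive_definite B \<Longrightarrow> 0 \<le> primal_norm B x"
  by (simp add: primal_norm_def matrix_inner_nonneg)

lemma primal_norm_sq: "positive_definite B \<Longrightarrow> (primal_norm B x)\<^sup>2 = (B *v x) \<bullet> x"
  by (simp add: primal_norm_def matrix_inner_nonneg)

lemma primal_norm_zero [simp]: "primal_norm B 0 = 0"
  by (simp add: primal_norm_def)

lemma primal_norm_pos: "positive_definite B \<Longrightarrow> x \<noteq> 0 \<Longrightarrow> 0 < primal_norm B x"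
  by (simp add: primal_norm_def positive_definite_def)

lemma primal_norm_scaleR: "positive_definite B \<Longrightarrow> primal_norm B (c *\<^sub>R x) = \<bar>c\<bar> * primal_norm B x"
  by (simp add: primal_norm_def matrix_vector_mult_scaleR real_sqrt_mult flip: power2_eq_square mult.assoc)

lemma primal_norm_minus_commute: "positive_definite B \<Longrightarrow> primal_norm B (x - y) = primal_norm B (y - x)"
  using primal_norm_scaleR[of B "-1" "x - y"] by simp

lemma continuous_primal_norm: "continuous_on S (primal_norm B)"
  unfolding primal_norm_def
  by (intro continuous_intros linear_continuous_on linear_conv_bounded_linear[THEN iffD1] matrix_vector_mul_linear)

lemma primal_norm_measurable [measurable]: "primal_norm B \<in> borel_measurable borel"
  by (intro borel_measurable_continuous_onI continuous_primal_norm)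

text \<open>Equality holds because the norm comes from an inner product: symmetry of
  \<open>B\<close> merges the two cross terms. The negative term is the strong convexity that
  \<open>prox_three_point\<close> exploits.\<close>

lemma primal_norm_sq_convex_combination:
  assumes "positive_definite B"
  shows "(primal_norm B ((1 - t) *\<^sub>R x + t *\<^sub>R y - v))\<^sup>2
    = (1 - t) * (primal_norm B (x - v))\<^sup>2 + t * (primal_norm B (y - v))\<^sup>2
      - t * (1 - t) * (primal_norm B (x - y))\<^sup>2"
proof -
  define p where "p = x - v"
  define q where "q = y - v"
  have "(1 - t) *\<^sub>R x + t *\<^sub>R y - v = (1 - t) *\<^sub>R p + t *\<^sub>R q" "x - y = p - q"
    by (simp_all add: p_def q_def algebra_simps)
  moreover have "(primal_norm B ((1 - t) *\<^sub>R p + t *\<^sub>R q))\<^sup>2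
    = (1 - t) * (primal_norm B p)\<^sup>2 + t * (primal_norm B q)\<^sup>2 - t * (1 - t) * (primal_norm B (p - q))\<^sup>2"
    using matrix_inner_commute[OF assms, of p q]
    by (simp add: primal_norm_sq assms matrix_vector_right_distrib matrix_vector_mult_diff_distrib
        matrix_vector_mult_scaleR inner_add inner_diff algebra_simps)
  ultimately show ?thesis by (simp add: p_def q_def)
qed

text \<open>The constant is the minimum of the continuous primal norm on the compact Euclidean unit
  sphere, positive by definiteness; homogeneity carries the bound to all vectors.\<close>

lemma primal_norm_lower:
  assumes "positive_definite (B :: real ^ 'n ^ 'n)"
  obtains c where "0 < c" "\<And>x. c * norm x \<le> primal_norm B x"
proof -
  let ?S = "sphere (0 :: real ^ 'n) 1"
  have "compact ?S" "?S \<noteq> {}" by auto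
  then obtain u where u: "u \<in> ?S" "\<And>x. x \<in> ?S \<Longrightarrow> primal_norm B u \<le> primal_norm B x"
    using continuous_attains_inf[OF _ _ continuous_primal_norm, of ?S B] by blast
  have "primal_norm B u * norm x \<le> primal_norm B x" for x
  proof (cases "x = 0")
    case False
    with u(2)[of "(1 / norm x) *\<^sub>R x"] show ?thesis
      by (simp add: primal_norm_scaleR assms field_simps)
  qed simp
  moreover have "0 < primal_norm B u" using u by (auto intro!: primal_norm_pos assms)
  ultimately show ?thesis by (rule that[rotated])
qed

text \<open>\<open>dual_norm\<close> is a supremum in the reals, so it carries information only for
  a nonempty set that is bounded above. Every later estimate on it rests on this fact and on
  \<open>primal_sphere_nonempty\<close>.\<close>

lemma dual_norm_bdd:
  assumes "positive_definite B"
  shows "bdd_above ((\<bullet>) s ` {x. primal_norm B x = 1})"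
proof -
  obtain c where c: "0 < c" "\<And>x. c * norm x \<le> primal_norm B x"
    using primal_norm_lower[OF assms] by blast
  have "s \<bullet> x \<le> norm s * (1 / c)" if "primal_norm B x = 1" for x
  proof -
    have "norm x \<le> 1 / c" using c(1) c(2)[of x] that by (simp add: field_simps)
    then show ?thesis
      using Cauchy_Schwarz_ineq2[of s x] mult_left_mono[of "norm x" "1 / c" "norm s"] by simp
  qed
  then show ?thesis by (intro bdd_aboveI2) auto
qed

lemma primal_sphere_nonempty:
  assumes "positive_definite (B :: real ^ 'n ^ 'n)"
  shows "{x. primal_norm B x = 1} \<noteq> {}"
proof -
  obtain u :: "real ^ 'n" where "u \<noteq> 0" by (metis norm_axis_1 norm_zero zero_neq_one)
  then have "primal_norm B ((1 / primal_norm B u) *\<^sub>R u) = 1"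
    using primal_norm_pos[OF assms, of u] by (simp add: primal_norm_scaleR assms)
  then show ?thesis by blast
qed

lemma inner_le_dual_primal:
  assumes "positive_definite B"
  shows "s \<bullet> x \<le> dual_norm B s * primal_norm B x"
proof (cases "x = 0")
  case False
  let ?n = "primal_norm B x"
  have n: "0 < ?n" by (rule primal_norm_pos[OF assms False])
  have "s \<bullet> ((1 / ?n) *\<^sub>R x) \<le> dual_norm B s"
    unfolding dual_norm_def using n
    by (intro cSUP_upper dual_norm_bdd assms) (simp add: primal_norm_scaleR assms)
  with n show ?thesis by (simp add: field_simps)
qed simp

lemma dual_norm_leI:
  assumes "positive_definite B" "\<And>x. primal_norm B x = 1 \<Longrightarrow> s \<bullet> x \<le> r"
  shows "dual_norm B s \<le> r"
  unfolding dual_norm_def using assms by (intro cSUP_least primal_sphere_nonempty) auto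

lemma dual_norm_triangle:
  assumes "positive_definite B"
  shows "dual_norm B (s + t) \<le> dual_norm B s + dual_norm B t"
proof (rule dual_norm_leI[OF assms])
  fix x assume "primal_norm B x = 1"
  then show "(s + t) \<bullet> x \<le> dual_norm B s + dual_norm B t"
    using inner_le_dual_primal[OF assms, of s x] inner_le_dual_primal[OF assms, of t x]
    by (simp add: inner_add_left)
qed

lemma dual_norm_minus:
  assumes "positive_definite B"
  shows "dual_norm B (- s) = dual_norm B s"
proof -
  have "dual_norm B (- s) \<le> dual_norm B s" for s
  proof (rule dual_norm_leI[OF assms])
    fix x assume "primal_norm B x = 1"
    then show "- s \<bullet> x \<le> dual_norm B s"
      using inner_le_dual_primal[OF assms, of s "-x"] primal_norm_scaleR[OF assms, of "-1" x] by simp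
  qed
  from this[of s] this[of "-s"] show ?thesis by simp
qed

lemma dual_norm_nonneg [simp]:
  assumes "positive_definite B"
  shows "0 \<le> dual_norm B s"
proof -
  obtain u where "primal_norm B u = 1" using primal_sphere_nonempty[OF assms] by blast
  then have "0 \<le> dual_norm B 0" using inner_le_dual_primal[OF assms, of 0 u] by simp
  also have "\<dots> \<le> dual_norm B s + dual_norm B (- s)"
    using dual_norm_triangle[OF assms, of s "-s"] by simp
  finally show ?thesis by (simp add: dual_norm_minus assms)
qed

lemma abs_inner_le_dual_primal:
  assumes "positive_definite B"
  shows "\<bar>s \<bullet> x\<bar> \<le> dual_norm B s * primal_norm B x"
  using inner_le_dual_primal[OF assms, of s x] inner_le_dual_primal[OF assms, of "-s" x]
  by (simp add: dual_norm_minus assms)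

lemma dual_norm_sq_add_le:
  assumes "positive_definite B"
  shows "(dual_norm B (s + t))\<^sup>2 \<le> 2 * (dual_norm B s)\<^sup>2 + 2 * (dual_norm B t)\<^sup>2"
proof -
  have "(dual_norm B (s + t))\<^sup>2 \<le> (dual_norm B s + dual_norm B t)\<^sup>2"
    by (intro power_mono dual_norm_triangle dual_norm_nonneg assms)
  also have "\<dots> \<le> 2 * (dual_norm B s)\<^sup>2 + 2 * (dual_norm B t)\<^sup>2"
    using sum_squares_bound[of "dual_norm B s" "dual_norm B t"] by (simp add: power2_sum)
  finally show ?thesis .
qed

text \<open>A supremum over an uncountable sphere is not measurable for free. The triangle
  inequality and the comparison with the Euclidean norm make it Lipschitz, hence continuous.\<close>

lemma dual_norm_measurable:
  assumes "positive_definite B"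
  shows "dual_norm B \<in> borel_measurable borel"
proof -
  obtain c where c: "0 < c" "\<And>x. c * norm x \<le> primal_norm B x"
    using primal_norm_lower[OF assms] by blast
  have le: "dual_norm B s \<le> (1 / c) * norm s" for s
  proof (rule dual_norm_leI[OF assms])
    fix x assume "primal_norm B x = 1"
    with c(1) c(2)[of x] have "norm x \<le> 1 / c" by (simp add: field_simps)
    then show "s \<bullet> x \<le> (1 / c) * norm s"
      using Cauchy_Schwarz_ineq2[of s x] mult_left_mono[of "norm x" "1 / c" "norm s"] by simp
  qed
  have diff: "dual_norm B s - dual_norm B t \<le> (1 / c) * norm (s - t)" for s t
    using dual_norm_triangle[OF assms, of "s - t" t] le[of "s - t"] by simp
  have "\<bar>dual_norm B s - dual_norm B t\<bar> \<le> (1 / c) * norm (s - t)" for s t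
    using diff[of s t] diff[of t s] by (simp add: abs_le_iff norm_minus_commute)
  then have "(1 / c)-lipschitz_on UNIV (dual_norm B)"
    using c(1) by (intro lipschitz_onI) (auto simp: dist_norm)
  then show ?thesis by (intro borel_measurable_continuous_onI lipschitz_on_continuous_on)
qed

subsection \<open>Extended-valued convex functions and the proximal map\<close>

lemma proper_ereal_real:
  assumes "proper_closed_convex \<psi>" "x \<in> eff_dom \<psi>"
  shows "\<psi> x = ereal (real_of_ereal (\<psi> x))"
  using assms by (cases "\<psi> x") (auto simp: proper_closed_convex_def eff_dom_def)

text \<open>Convexity of the epigraph, applied to two points of the graph, yields at once that the
  domain is convex and that the real values satisfy the convexity inequality.\<close>

lemma convex_real_of_proper:
  assumes "proper_closed_convex \<psi>"
  shows "convex_on (eff_dom \<psi>) (\<lambda>x. real_of_ereal (\<psi> x))"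
proof -
  have *: "(1 - t) *\<^sub>R x + t *\<^sub>R y \<in> eff_dom \<psi> \<and>
      real_of_ereal (\<psi> ((1 - t) *\<^sub>R x + t *\<^sub>R y))
        \<le> (1 - t) * real_of_ereal (\<psi> x) + t * real_of_ereal (\<psi> y)"
    if xy: "x \<in> eff_dom \<psi>" "y \<in> eff_dom \<psi>" and t: "0 \<le> t" "t \<le> 1" for x y t
  proof -
    let ?z = "(1 - t) *\<^sub>R x + t *\<^sub>R y"
    let ?r = "(1 - t) * real_of_ereal (\<psi> x) + t * real_of_ereal (\<psi> y)"
    have "convex (ereal_epigraph \<psi>)" using assms by (simp add: proper_closed_convex_def)
    moreover have "(x, real_of_ereal (\<psi> x)) \<in> ereal_epigraph \<psi>" "(y, real_of_ereal (\<psi> y)) \<in> ereal_epigraph \<psi>"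
      using proper_ereal_real[OF assms] xy by (auto simp: ereal_epigraph_def)
    ultimately have "(1 - t) *\<^sub>R (x, real_of_ereal (\<psi> x)) + t *\<^sub>R (y, real_of_ereal (\<psi> y)) \<in> ereal_epigraph \<psi>"
      using t by (intro convexD_alt[of "ereal_epigraph \<psi>"]) auto
    then have z: "\<psi> ?z \<le> ereal ?r" by (simp add: ereal_epigraph_def)
    then have dom: "?z \<in> eff_dom \<psi>" unfolding eff_dom_def by (auto simp: less_top[symmetric])
    moreover have "real_of_ereal (\<psi> ?z) \<le> ?r"
      using z proper_ereal_real[OF assms dom] by (metis ereal_less_eq(3))
    ultimately show ?thesis by blast
  qed
  show ?thesis
  proof (rule convex_onI)
    show "convex (eff_dom \<psi>)"
      unfolding convex_alt using * by auto
  qed (use * in auto)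
qed

text \<open>Real sublevel sets are sections of the closed epigraph, hence closed.\<close>

lemma proper_closed_convex_measurable:
  fixes \<psi> :: "'a :: euclidean_space \<Rightarrow> ereal"
  assumes "proper_closed_convex \<psi>"
  shows "\<psi> \<in> borel_measurable borel"
  unfolding borel_measurable_iff_Iic_ereal
proof
  fix a :: ereal
  have real: "closed (\<psi> -` {..ereal r})" for r
  proof -
    have "closed ((\<lambda>x. (x, r)) -` ereal_epigraph \<psi>)"
      using assms by (intro closed_vimage continuous_intros) (auto simp: proper_closed_convex_def)
    also have "(\<lambda>x. (x, r)) -` ereal_epigraph \<psi> = \<psi> -` {..ereal r}"
      by (auto simp: ereal_epigraph_def)
    finally show ?thesis .
  qed
  have "\<psi> -` {..a} \<in> sets borel"
  proof (cases a)
    case MInf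
    then have "\<psi> -` {..a} = {}" using assms by (auto simp: proper_closed_convex_def)
    then show ?thesis by simp
  next
    case PInf
    then have "\<psi> -` {..a} = UNIV" by auto
    then show ?thesis by simp
  qed (use real in auto)
  then show "\<psi> -` {..a} \<inter> space borel \<in> sets borel" by simp
qed

text \<open>Quadratic growth at a minimizer, obtained without derivatives: compare \<open>p\<close>
  with the point at parameter \<open>t\<close> on the segment to \<open>z\<close>, divide the gain
  by \<open>t\<close>, and let \<open>t\<close> decrease to 0.\<close>

lemma prox_three_point:
  assumes B: "positive_definite B" and \<psi>: "proper_closed_convex \<psi>"
    and p: "p \<in> Prox B \<psi> v s m" and z: "z \<in> eff_dom \<psi>"
  shows "s \<bullet> p + real_of_ereal (\<psi> p) + m / 2 * (primal_norm B (p - v))\<^sup>2 + m / 2 * (primal_norm B (p - z))\<^sup>2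
    \<le> s \<bullet> z + real_of_ereal (\<psi> z) + m / 2 * (primal_norm B (z - v))\<^sup>2"
proof -
  define h where "h y = s \<bullet> y + real_of_ereal (\<psi> y) + m / 2 * (primal_norm B (y - v))\<^sup>2" for y
  let ?d = "m / 2 * (primal_norm B (p - z))\<^sup>2"
  have pdom: "p \<in> eff_dom \<psi>" using p by (simp add: Prox_def is_arg_min_def)
  have opt: "h p \<le> h y" if y: "y \<in> eff_dom \<psi>" for y
  proof -
    have "\<not> ereal (s \<bullet> y) + \<psi> y + ereal (m / 2 * (primal_norm B (y - v))\<^sup>2)
        < ereal (s \<bullet> p) + \<psi> p + ereal (m / 2 * (primal_norm B (p - v))\<^sup>2)"
      using p y by (simp add: Prox_def is_arg_min_def)
    then show ?thesis
      by (subst (asm) proper_ereal_real[OF \<psi> y], subst (asm) proper_ereal_real[OF \<psi> pdom])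
        (simp add: h_def)
  qed
  have conv: "convex_on (eff_dom \<psi>) (\<lambda>x. real_of_ereal (\<psi> x))" by (rule convex_real_of_proper[OF \<psi>])
  have *: "h p + (1 - t) * ?d \<le> h z" if t: "0 < t" "t < 1" for t
  proof -
    let ?w = "(1 - t) *\<^sub>R p + t *\<^sub>R z"
    have w: "?w \<in> eff_dom \<psi>"
      using conv pdom z t by (auto simp: convex_on_def convex_alt)
    have c: "real_of_ereal (\<psi> ?w) \<le> (1 - t) * real_of_ereal (\<psi> p) + t * real_of_ereal (\<psi> z)"
      using convex_onD[OF conv, of t p z] pdom z t by auto
    have "h p \<le> h ?w" by (rule opt[OF w])
    also have "h ?w \<le> (1 - t) * h p + t * h z - t * ((1 - t) * ?d)"
    proof -
      have "h ?w \<le> (1 - t) * (s \<bullet> p) + t * (s \<bullet> z)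
          + ((1 - t) * real_of_ereal (\<psi> p) + t * real_of_ereal (\<psi> z))
          + m / 2 * (primal_norm B (?w - v))\<^sup>2"
        using c by (simp add: h_def inner_add_right)
      then show ?thesis
        unfolding primal_norm_sq_convex_combination[OF B] h_def by argo
    qed
    finally have "t * (h p + (1 - t) * ?d) \<le> t * h z" by (simp add: algebra_simps)
    then show ?thesis using t by simp
  qed
  have "((\<lambda>t. h p + (1 - t) * ?d) \<longlongrightarrow> h p + (1 - 0) * ?d) (at_right 0)"
    by (intro tendsto_intros)
  moreover have "\<forall>\<^sub>F t in at_right 0. h p + (1 - t) * ?d \<le> h z"
    using * by (auto simp: eventually_at_right_field intro!: exI[of _ 1])
  ultimately have "h p + (1 - 0) * ?d \<le> h z"
    by (intro tendsto_upperbound[of "\<lambda>t. h p + (1 - t) * ?d"]) auto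
  then show ?thesis by (simp add: h_def)
qed

subsection \<open>One step of the method\<close>

text \<open>Convexity of \<psi>, the linear model of \<open>f\<close> at \<open>y\<close> and the
  prox inequality are added with weights \<open>A\<close> and \<open>a\<close>. The term
  \<open>lin_error f fbar gbar xp y\<close> is put on both sides so that the last bracket becomes
  the left-hand integrand of the stepsize requirement with \<Omega> =
  \<open>a\<^sup>2 / (A + a)\<^sup>2 * D\<^sup>2\<close>.\<close>

lemma accelerated_step:
  fixes f fbar :: "real ^ 'n \<Rightarrow> real"
  assumes B: "positive_definite B" and \<psi>: "proper_closed_convex \<psi>"
    and a: "0 < a" and A: "0 \<le> A"
    and dom: "x \<in> eff_dom \<psi>" "z \<in> eff_dom \<psi>"
    and y: "y = (A / (A + a)) *\<^sub>R x + (a / (A + a)) *\<^sub>R v"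
    and vp: "vp \<in> Prox B \<psi> v s (m / a)"
    and xp: "xp = (A / (A + a)) *\<^sub>R x + (a / (A + a)) *\<^sub>R vp"
    and M: "M = (A + a) / a\<^sup>2 * m" and M': "m' = a\<^sup>2 / (A + a) * M'" and le: "M \<le> M'"
    and D: "primal_norm B (vp - v) \<le> D" "primal_norm B (vp - z) \<le> D"
  defines "F \<equiv> \<lambda>u. f u + real_of_ereal (\<psi> u)"
  shows "(A + a) * (F xp - F z) + m' / 2 * (primal_norm B (vp - z))\<^sup>2
      + A * lin_error f fbar gbar y x + a * lin_error f fbar gbar y z
      + (A + a) * lin_error f fbar gbar xp y
    \<le> A * (F x - F z) + m / 2 * (primal_norm B (v - z))\<^sup>2 + a * ((gbar y - s) \<bullet> (v - z))
      + (A + a) * (Delta_hat B f fbar gbar y xp s M' + (M' - M) * (a\<^sup>2 / (A + a)\<^sup>2 * D\<^sup>2)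
        + lin_error f fbar gbar xp y)"
proof -
  define T where "T = A + a"
  have T: "0 < T" using a A by (simp add: T_def)
  have Ty: "T *\<^sub>R y = A *\<^sub>R x + a *\<^sub>R v" and Tx: "T *\<^sub>R xp = A *\<^sub>R x + a *\<^sub>R vp"
    using T by (simp_all add: y xp T_def[symmetric] scaleR_add_right)
  have Td: "T *\<^sub>R (xp - y) = a *\<^sub>R (vp - v)"
    using Ty Tx by (simp add: scaleR_diff_right)
  have vpdom: "vp \<in> eff_dom \<psi>" using vp by (simp add: Prox_def is_arg_min_def)

  have c: "real_of_ereal (\<psi> xp) \<le> (1 - a / T) * real_of_ereal (\<psi> x) + a / T * real_of_ereal (\<psi> vp)"
  proof -
    have "xp = (1 - a / T) *\<^sub>R x + (a / T) *\<^sub>R vp"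
      using T by (simp add: xp T_def field_simps)
    then show ?thesis
      using convex_onD[OF convex_real_of_proper[OF \<psi>], of "a / T" x vp] dom vpdom a A
      by (simp add: T_def)
  qed
  have "T * (1 - a / T) = A" "T * (a / T) = a"
    using T by (simp_all add: right_diff_distrib) (simp add: T_def)
  then have "T * ((1 - a / T) * r + a / T * q) = A * r + a * q" for r q
    by (metis distrib_left mult.assoc)
  then have psi: "T * real_of_ereal (\<psi> xp) \<le> A * real_of_ereal (\<psi> x) + a * real_of_ereal (\<psi> vp)"
    using mult_left_mono[OF c, of T] T by simp

  have prox: "a * (s \<bullet> vp) + a * real_of_ereal (\<psi> vp) + m / 2 * (primal_norm B (vp - v))\<^sup>2
        + m / 2 * (primal_norm B (vp - z))\<^sup>2
      \<le> a * (s \<bullet> z) + a * real_of_ereal (\<psi> z) + m / 2 * (primal_norm B (v - z))\<^sup>2"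
    using mult_left_mono[OF prox_three_point[OF B \<psi> vp dom(2)], of a] a
    by (simp add: algebra_simps primal_norm_minus_commute[OF B, of z v])

  have "T * primal_norm B (xp - y) = a * primal_norm B (vp - v)"
    using arg_cong[OF Td, of "primal_norm B"] T a by (simp add: primal_norm_scaleR[OF B])
  then have sq: "T\<^sup>2 * (primal_norm B (xp - y))\<^sup>2 = a\<^sup>2 * (primal_norm B (vp - v))\<^sup>2"
    by (metis power_mult_distrib)
  have TM: "T * (M' / 2 * (primal_norm B (xp - y))\<^sup>2) = m' / 2 * (primal_norm B (vp - v))\<^sup>2"
    using sq T a by (simp add: M' T_def[symmetric] field_simps power2_eq_square)
  have TD: "T * ((M' - M) * (a\<^sup>2 / T\<^sup>2 * D\<^sup>2)) = (m' - m) * D\<^sup>2"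
    using T a by (simp add: M M' T_def[symmetric] field_simps power2_eq_square)
  have mm: "m \<le> m'"
  proof -
    have "m = a\<^sup>2 / T * M" using T a by (simp add: M T_def[symmetric])
    also have "\<dots> \<le> m'" using le T unfolding M' T_def[symmetric] by (intro mult_left_mono) auto
    finally show ?thesis .
  qed
  \<comment> \<open>The prox inequality supplies the old coefficient \<open>m\<close>, but the new
    potential and \<open>Delta_hat\<close> both use \<open>m'\<close>. The diameter bounds this
    mismatch, and its cost is exactly the \<Omega>-term, by \<open>TD\<close>.\<close>
  have dist: "(m' - m) / 2 * (primal_norm B (vp - v))\<^sup>2 + (m' - m) / 2 * (primal_norm B (vp - z))\<^sup>2
      \<le> (m' - m) * D\<^sup>2"
  proof -
    have "(primal_norm B (vp - v))\<^sup>2 \<le> D\<^sup>2" "(primal_norm B (vp - z))\<^sup>2 \<le> D\<^sup>2"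
      using D B by (auto intro!: power_mono)
    then have "(m' - m) / 2 * (primal_norm B (vp - v))\<^sup>2 \<le> (m' - m) / 2 * D\<^sup>2"
        "(m' - m) / 2 * (primal_norm B (vp - z))\<^sup>2 \<le> (m' - m) / 2 * D\<^sup>2"
      using mm by (auto intro!: mult_left_mono)
    then show ?thesis by argo
  qed

  have Delta: "T * Delta_hat B f fbar gbar y xp s M' = T * lin_error f fbar gbar y xp
      + a * ((gbar y - s) \<bullet> (vp - v)) - m' / 2 * (primal_norm B (vp - v))\<^sup>2"
  proof -
    have "T * ((gbar y - s) \<bullet> (xp - y)) = a * ((gbar y - s) \<bullet> (vp - v))"
      using arg_cong[OF Td, of "\<lambda>w. (gbar y - s) \<bullet> w"] by (simp only: inner_scaleR_right)
    then show ?thesis using TM by (simp add: Delta_hat_def algebra_simps)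
  qed
  \<comment> \<open>The linear model at \<open>y\<close> is affine, so its value at
    \<open>xp\<close> splits into values at \<open>x\<close> and \<open>vp\<close>; then
    \<open>vp\<close> is exchanged for \<open>z\<close> at the price of the last inner
    product.\<close>
  have smooth: "T * f xp - T * lin_error f fbar gbar y xp = A * f x - A * lin_error f fbar gbar y x
      + a * f z - a * lin_error f fbar gbar y z + a * (gbar y \<bullet> (vp - z))"
  proof -
    have "T * (gbar y \<bullet> xp) = A * (gbar y \<bullet> x) + a * (gbar y \<bullet> vp)"
      using arg_cong[OF Tx, of "\<lambda>w. gbar y \<bullet> w"] by (simp add: inner_add_right)
    then show ?thesis by (simp add: lin_error_def inner_diff_right algebra_simps T_def)
  qed
  \<comment> \<open>The error of the oracle is split at \<open>v\<close>. In the algorithm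
    \<open>v\<close> is known before the answer \<open>s\<close>, so the part against
    \<open>v - z\<close> will have mean zero; the part against \<open>vp - v\<close> depends on
    \<open>s\<close> and is absorbed by \<open>Delta_hat\<close>.\<close>
  have inner: "a * (gbar y \<bullet> (vp - z)) = a * ((gbar y - s) \<bullet> (vp - v)) + a * ((gbar y - s) \<bullet> (v - z))
      + a * (s \<bullet> vp) - a * (s \<bullet> z)"
    by (simp add: inner_diff_left inner_diff_right algebra_simps)
  have zT: "T * f z = A * f z + a * f z"
      "T * real_of_ereal (\<psi> z) = A * real_of_ereal (\<psi> z) + a * real_of_ereal (\<psi> z)"
    by (simp_all add: T_def distrib_right)
  show ?thesis
    unfolding T_def[symmetric] F_def distrib_left right_diff_distrib TD Delta
    using psi prox dist smooth inner zT by argo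
qed

subsection \<open>Oracle queries with fresh randomness\<close>

text \<open>Independence from the whole of \<open>H\<close> gives independence from any
  \<open>H\<close>-measurable \<open>Y\<close>; on rectangles this is the product formula, which
  determines the joint law.\<close>

lemma fresh_copy_joint_distr:
  assumes P: "prob_space P" and H: "subalgebra P H" and Y: "Y \<in> measurable H N"
    and \<zeta>: "fresh_copy P \<Xi> H \<zeta>"
  shows "distr P (N \<Otimes>\<^sub>M \<Xi>) (\<lambda>\<omega>. (Y \<omega>, \<zeta> \<omega>)) = distr P N Y \<Otimes>\<^sub>M \<Xi>"
proof -
  interpret prob_space P by fact
  have YP: "random_variable N Y" using Y H by (rule measurable_from_subalg[rotated])
  have \<zeta>P: "random_variable \<Xi> \<zeta>" and d: "distr P \<Xi> \<zeta> = \<Xi>"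
    using \<zeta> by (auto simp: fresh_copy_def)
  have "indep_set (sets (vimage_algebra (space P) \<zeta> \<Xi>)) (sets H)"
    using \<zeta> by (simp add: fresh_copy_def)
  then have ind: "prob (a \<inter> b) = prob a * prob b"
    if "a \<in> sets (vimage_algebra (space P) \<zeta> \<Xi>)" "b \<in> sets H" for a b
    using that by (simp add: indep_sets2_eq)
  show ?thesis
  proof (rule pair_measure_eqI[symmetric])
    show "sigma_finite_measure (distr P N Y)" "sigma_finite_measure \<Xi>"
      using prob_space_distr[OF YP] prob_space_distr[OF \<zeta>P] d
      by (auto intro: prob_space_imp_sigma_finite)
    show "sets (distr P N Y \<Otimes>\<^sub>M \<Xi>) = sets (distr P (N \<Otimes>\<^sub>M \<Xi>) (\<lambda>\<omega>. (Y \<omega>, \<zeta> \<omega>)))"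
      by (simp cong: sets_pair_measure_cong)
    fix S T assume S: "S \<in> sets (distr P N Y)" and T: "T \<in> sets \<Xi>"
    have "Y -` S \<inter> space P \<in> sets H"
      using measurable_sets[OF Y] S H by (simp add: subalgebra_def)
    moreover have "\<zeta> -` T \<inter> space P \<in> sets (vimage_algebra (space P) \<zeta> \<Xi>)"
      using T by (rule in_vimage_algebra)
    ultimately have "prob (\<zeta> -` T \<inter> space P \<inter> (Y -` S \<inter> space P))
        = prob (\<zeta> -` T \<inter> space P) * prob (Y -` S \<inter> space P)"
      by (intro ind)
    moreover have "\<zeta> -` T \<inter> space P \<inter> (Y -` S \<inter> space P) = (\<lambda>\<omega>. (Y \<omega>, \<zeta> \<omega>)) -` (S \<times> T) \<inter> space P"
      by auto
    moreover have "emeasure \<Xi> T = emeasure P (\<zeta> -` T \<inter> space P)"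
      using emeasure_distr[OF \<zeta>P T] d by simp
    ultimately show "emeasure (distr P N Y) S * emeasure \<Xi> T
        = emeasure (distr P (N \<Otimes>\<^sub>M \<Xi>) (\<lambda>\<omega>. (Y \<omega>, \<zeta> \<omega>))) (S \<times> T)"
      using S T YP \<zeta>P by (simp add: emeasure_distr emeasure_eq_measure mult.commute flip: ennreal_mult)
  qed
qed

text \<open>Tonelli for the product law: the fresh argument is integrated out with \<open>Y\<close>
  frozen. This stands in for conditioning on \<open>H\<close>.\<close>

lemma fresh_copy_nn_integral:
  assumes P: "prob_space P" and \<Xi>: "prob_space \<Xi>"
    and H: "subalgebra P H" and Y: "Y \<in> measurable H N" and \<zeta>: "fresh_copy P \<Xi> H \<zeta>"
    and h: "h \<in> borel_measurable (N \<Otimes>\<^sub>M \<Xi>)"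
  shows "(\<integral>\<^sup>+\<omega>. h (Y \<omega>, \<zeta> \<omega>) \<partial>P) = (\<integral>\<^sup>+\<omega>. \<integral>\<^sup>+s. h (Y \<omega>, s) \<partial>\<Xi> \<partial>P)"
proof -
  interpret \<Xi>: prob_space \<Xi> by fact
  have YP: "Y \<in> measurable P N" using Y H by (rule measurable_from_subalg[rotated])
  have \<zeta>P: "\<zeta> \<in> measurable P \<Xi>" using \<zeta> by (simp add: fresh_copy_def)
  have "(\<integral>\<^sup>+\<omega>. h (Y \<omega>, \<zeta> \<omega>) \<partial>P) = (\<integral>\<^sup>+p. h p \<partial>distr P (N \<Otimes>\<^sub>M \<Xi>) (\<lambda>\<omega>. (Y \<omega>, \<zeta> \<omega>)))"
    using h YP \<zeta>P by (subst nn_integral_distr) auto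
  also have "\<dots> = (\<integral>\<^sup>+p. h p \<partial>(distr P N Y \<Otimes>\<^sub>M \<Xi>))"
    by (simp add: fresh_copy_joint_distr[OF P H Y \<zeta>])
  also have "\<dots> = (\<integral>\<^sup>+p. \<integral>\<^sup>+s. h (p, s) \<partial>\<Xi> \<partial>distr P N Y)"
    using h by (subst \<Xi>.nn_integral_fst[symmetric]) (auto cong: measurable_cong_sets)
  also have "\<dots> = (\<integral>\<^sup>+\<omega>. \<integral>\<^sup>+s. h (Y \<omega>, s) \<partial>\<Xi> \<partial>P)"
    using h YP \<Xi>.borel_measurable_nn_integral_fst[OF h] by (subst nn_integral_distr) auto
  finally show ?thesis .
qed

text \<open>The signed counterpart by Fubini, for integrands that average to zero over the query for
  every frozen value.\<close>

lemma fresh_copy_integral_eq_0: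
  fixes h :: "_ \<Rightarrow> real"
  assumes P: "prob_space P" and \<Xi>: "prob_space \<Xi>"
    and H: "subalgebra P H" and Y: "Y \<in> measurable H N" and \<zeta>: "fresh_copy P \<Xi> H \<zeta>"
    and h: "h \<in> borel_measurable (N \<Otimes>\<^sub>M \<Xi>)"
    and int: "integrable P (\<lambda>\<omega>. h (Y \<omega>, \<zeta> \<omega>))"
    and zero: "\<And>p. (\<integral>s. h (p, s) \<partial>\<Xi>) = 0"
  shows "(\<integral>\<omega>. h (Y \<omega>, \<zeta> \<omega>) \<partial>P) = 0"
proof -
  interpret prob_P: prob_space P by fact
  have YP: "Y \<in> measurable P N" using Y H by (rule measurable_from_subalg[rotated])
  have \<zeta>P: "\<zeta> \<in> measurable P \<Xi>" using \<zeta> by (simp add: fresh_copy_def)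
  interpret Y: prob_space "distr P N Y" by (rule prob_P.prob_space_distr[OF YP])
  interpret \<Xi>: prob_space \<Xi> by fact
  interpret pair_prob_space "distr P N Y" \<Xi> ..
  note joint = fresh_copy_joint_distr[OF P H Y \<zeta>]
  have m: "(\<lambda>\<omega>. (Y \<omega>, \<zeta> \<omega>)) \<in> measurable P (N \<Otimes>\<^sub>M \<Xi>)" using YP \<zeta>P by simp
  have "integrable (distr P N Y \<Otimes>\<^sub>M \<Xi>) h"
    using int integrable_distr_eq[OF m h] by (simp add: joint)
  then have "(\<integral>p. (\<integral>s. h (p, s) \<partial>\<Xi>) \<partial>distr P N Y) = (\<integral>p. h p \<partial>(distr P N Y \<Otimes>\<^sub>M \<Xi>))"
    by (rule integral_fst')
  moreover have "(\<integral>\<omega>. h (Y \<omega>, \<zeta> \<omega>) \<partial>P) = (\<integral>p. h p \<partial>(distr P N Y \<Otimes>\<^sub>M \<Xi>))"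
    using integral_distr[OF m h] by (simp add: joint)
  ultimately show ?thesis by (simp add: zero)
qed

lemma oracle_section_measurable:
  assumes "stochastic_oracle \<Xi> g"
  shows "g x \<in> borel_measurable \<Xi>"
  using assms measurable_Pair2[of "\<lambda>(x, s). g x s" borel \<Xi> borel x]
  by (simp add: stochastic_oracle_def)

lemma unbiased_oracle_mean_measurable:
  assumes "stochastic_oracle \<Xi> g" "unbiased_oracle \<Xi> g gbar"
  shows "gbar \<in> borel_measurable borel"
proof -
  interpret prob_space \<Xi> using assms(1) by (simp add: stochastic_oracle_def)
  have "(\<lambda>x. \<integral>s. g x s \<partial>\<Xi>) \<in> borel_measurable borel"
    using assms(1) by (intro borel_measurable_lebesgue_integral) (simp add: stochastic_oracle_def)
  then show ?thesis using assms(2) by (simp add: unbiased_oracle_def)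
qed

lemma oracle_error_measurable:
  assumes "positive_definite B" "stochastic_oracle \<Xi> g" "unbiased_oracle \<Xi> g gbar"
  shows "(\<lambda>(x, s). dual_norm B (g x s - gbar x)) \<in> borel_measurable (borel \<Otimes>\<^sub>M \<Xi>)"
proof -
  note [measurable] = dual_norm_measurable[OF assms(1)] unbiased_oracle_mean_measurable[OF assms(2,3)]
  have [measurable]: "(\<lambda>p. g (fst p) (snd p)) \<in> borel_measurable (borel \<Otimes>\<^sub>M \<Xi>)"
    using assms(2) by (simp add: stochastic_oracle_def case_prod_beta')
  show ?thesis unfolding case_prod_beta' by measurable
qed

lemma Var_measurable:
  assumes "positive_definite B" "stochastic_oracle \<Xi> g" "unbiased_oracle \<Xi> g gbar"
  shows "Var B \<Xi> g gbar \<in> borel_measurable borel"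
proof -
  interpret prob_space \<Xi> using assms(2) by (simp add: stochastic_oracle_def)
  have "(\<lambda>(x, s). (dual_norm B (g x s - gbar x))\<^sup>2) \<in> borel_measurable (borel \<Otimes>\<^sub>M \<Xi>)"
    using oracle_error_measurable[OF assms] by (simp add: case_prod_beta')
  then show ?thesis unfolding Var_def[abs_def] by (rule borel_measurable_lebesgue_integral)
qed

lemma Var_nonneg: "0 \<le> Var B \<Xi> g gbar x"
  by (simp add: Var_def)

text \<open>The error at \<open>x\<close> is the difference of the errors at \<open>x\<close> and
  \<open>y\<close> plus the error at \<open>y\<close>; squaring a sum costs a factor 2.\<close>

lemma Var_le_Var2:
  assumes B: "positive_definite B" and g: "stochastic_oracle \<Xi> g" and fin: "finite_variance B \<Xi> g gbar"
  shows "Var B \<Xi> g gbar x \<le> 2 * Var2 B \<Xi> g gbar x y + 2 * Var B \<Xi> g gbar y"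
proof -
  note [measurable] = dual_norm_measurable[OF B] oracle_section_measurable[OF g]
  let ?e = "\<lambda>x s. (dual_norm B (g x s - gbar x))\<^sup>2"
  let ?d = "\<lambda>s. (dual_norm B ((g x s - g y s) - (gbar x - gbar y)))\<^sup>2"
  have ie: "integrable \<Xi> (?e x)" for x using fin by (simp add: finite_variance_def)
  \<comment> \<open>Integrability of \<open>?d\<close> has to come first: otherwise its Bochner
    integral would be the default value 0 and \<open>Var2\<close> would control nothing.\<close>
  have "?d s \<le> 2 * ?e x s + 2 * ?e y s" for s
    using dual_norm_sq_add_le[OF B, of "g x s - gbar x" "- (g y s - gbar y)"]
    by (simp add: dual_norm_minus[OF B, of "g y s - gbar y", simplified] algebra_simps)
  then have id: "integrable \<Xi> ?d"
    by (intro Bochner_Integration.integrable_bound[of _ "\<lambda>s. 2 * ?e x s + 2 * ?e y s" ?d]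
        Bochner_Integration.integrable_add integrable_mult_right ie) (auto simp: dual_norm_nonneg[OF B])
  have "?e x s \<le> 2 * ?d s + 2 * ?e y s" for s
    using dual_norm_sq_add_le[OF B, of "(g x s - g y s) - (gbar x - gbar y)" "g y s - gbar y"]
    by (simp add: algebra_simps)
  then have "(\<integral>s. ?e x s \<partial>\<Xi>) \<le> (\<integral>s. 2 * ?d s + 2 * ?e y s \<partial>\<Xi>)"
    by (intro integral_mono Bochner_Integration.integrable_add integrable_mult_right ie id)
  also have "\<dots> = 2 * (\<integral>s. ?d s \<partial>\<Xi>) + 2 * (\<integral>s. ?e y s \<partial>\<Xi>)"
    using ie id by simp
  finally show ?thesis by (simp add: Var_def Var2_def)
qed

text \<open>With \<open>Y\<close> frozen, the second moment of the error is the variance at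
  \<open>Y\<close>; a uniform bound on it along the run makes the full second moment finite.\<close>

lemma fresh_query_square_integrable:
  assumes P: "prob_space P" and B: "positive_definite B" and g: "stochastic_oracle \<Xi> g"
    and u: "unbiased_oracle \<Xi> g gbar" and fin: "finite_variance B \<Xi> g gbar"
    and H: "subalgebra P H" and Y: "Y \<in> borel_measurable H" and \<zeta>: "fresh_copy P \<Xi> H \<zeta>"
    and bound: "\<And>\<omega>. \<omega> \<in> space P \<Longrightarrow> Var B \<Xi> g gbar (Y \<omega>) \<le> C"
  shows "integrable P (\<lambda>\<omega>. (dual_norm B (g (Y \<omega>) (\<zeta> \<omega>) - gbar (Y \<omega>)))\<^sup>2)"
proof -
  interpret P: prob_space P by fact
  have \<Xi>: "prob_space \<Xi>" using g by (simp add: stochastic_oracle_def)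
  have YP: "Y \<in> borel_measurable P" using Y H by (rule measurable_from_subalg[rotated])
  have \<zeta>P: "\<zeta> \<in> measurable P \<Xi>" using \<zeta> by (simp add: fresh_copy_def)
  define e where "e = (\<lambda>(x, s). (dual_norm B (g x s - gbar x))\<^sup>2)"
  have e: "e \<in> borel_measurable (borel \<Otimes>\<^sub>M \<Xi>)"
    using oracle_error_measurable[OF B g u] by (simp add: e_def case_prod_beta')
  have "(\<integral>\<^sup>+\<omega>. ennreal (e (Y \<omega>, \<zeta> \<omega>)) \<partial>P) = (\<integral>\<^sup>+\<omega>. \<integral>\<^sup>+s. ennreal (e (Y \<omega>, s)) \<partial>\<Xi> \<partial>P)"
    using e by (intro fresh_copy_nn_integral[OF P \<Xi> H Y \<zeta>, where h = "\<lambda>p. ennreal (e p)"]) simp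
  also have "\<dots> = (\<integral>\<^sup>+\<omega>. ennreal (Var B \<Xi> g gbar (Y \<omega>)) \<partial>P)"
    using fin by (intro nn_integral_cong)
      (simp add: e_def Var_def finite_variance_def nn_integral_eq_integral)
  also have "\<dots> \<le> (\<integral>\<^sup>+\<omega>. ennreal C \<partial>P)"
    using bound by (intro nn_integral_mono ennreal_leI)
  also have "\<dots> < \<infinity>" by (simp add: P.emeasure_space_1)
  finally have "(\<integral>\<^sup>+\<omega>. ennreal (e (Y \<omega>, \<zeta> \<omega>)) \<partial>P) < \<infinity>" .
  moreover have "(\<lambda>\<omega>. e (Y \<omega>, \<zeta> \<omega>)) \<in> borel_measurable P"
    using e YP \<zeta>P by measurable
  ultimately have "integrable P (\<lambda>\<omega>. e (Y \<omega>, \<zeta> \<omega>))"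
    by (intro integrableI_nonneg) (auto simp: e_def)
  then show ?thesis by (simp add: e_def)
qed

text \<open>The right-hand side is smallest at \<nu> = \<open>sqrt (p / q)\<close>. For
  \<open>p = 0\<close>, which is how vanishing variance appears in \<open>rate\<close>, the infimum
  is not attained and is approached through \<nu> = \<open>e / q\<close>.\<close>

lemma le_optimal_tradeoff:
  fixes z p q :: real
  assumes p: "0 \<le> p" and q: "0 < q" and bound: "\<And>\<nu>. 0 < \<nu> \<Longrightarrow> z \<le> p / \<nu> + q * \<nu>"
  shows "z \<le> 2 * sqrt (p * q)"
proof (cases "p = 0")
  case True
  have "z \<le> 0 + e" if "0 < e" for e
    using bound[of "e / q"] that q True by simp
  then show ?thesis using True field_le_epsilon[of z 0] by simp
next
  case False
  define u where "u = sqrt p"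
  define w where "w = sqrt q"
  have uw: "0 < u" "0 < w" "p = u\<^sup>2" "q = w\<^sup>2"
    using p q False by (auto simp: u_def w_def)
  have "z \<le> u\<^sup>2 / (u / w) + w\<^sup>2 * (u / w)"
    using bound[of "u / w"] uw by simp
  also have "\<dots> = 2 * (u * w)" using uw by (simp add: power2_eq_square)
  also have "\<dots> = 2 * sqrt (p * q)" by (simp add: u_def w_def real_sqrt_mult)
  finally show ?thesis .
qed

subsection \<open>Runs of the accelerated method\<close>

locale fast_sgd_run =
  fixes P :: "'w measure" and \<Xi> :: "'s measure"
    and B :: "real ^ 'n ^ 'n"
    and f fbar :: "real ^ 'n \<Rightarrow> real" and gbar :: "real ^ 'n \<Rightarrow> real ^ 'n"
    and \<psi> :: "real ^ 'n \<Rightarrow> ereal"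
    and g :: "real ^ 'n \<Rightarrow> 's \<Rightarrow> real ^ 'n"
    and Mplus :: "real \<Rightarrow> real \<Rightarrow> real ^ 'n \<Rightarrow> real ^ 'n \<Rightarrow> real ^ 'n \<Rightarrow> real ^ 'n \<Rightarrow> real"
    and x v y :: "nat \<Rightarrow> 'w \<Rightarrow> real ^ 'n" and M :: "nat \<Rightarrow> 'w \<Rightarrow> real"
    and H :: "nat \<Rightarrow> 'w measure" and \<zeta> :: "nat \<Rightarrow> 'w \<Rightarrow> 's"
    and x0 xstar :: "real ^ 'n"
    and D \<delta>f Lf \<delta>g Lg c1 c2 c3 c4 :: real
  assumes prob: "prob_space P"
    and B: "positive_definite B"
    and f_convex: "convex_on UNIV f" and \<psi>: "proper_closed_convex \<psi>"
    and solution: "is_solution f \<psi> xstar"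
    and smooth: "approx_smooth B f fbar gbar \<delta>f Lf" and fbar: "fbar \<in> borel_measurable borel"
    and diam: "\<forall>x\<in>eff_dom \<psi>. \<forall>y\<in>eff_dom \<psi>. primal_norm B (x - y) \<le> D"
    and g_oracle: "stochastic_oracle \<Xi> g" and unbiased: "unbiased_oracle \<Xi> g gbar"
    and finite_var: "finite_variance B \<Xi> g gbar"
    and \<delta>g: "0 \<le> \<delta>g" and Lg: "0 \<le> Lg"
    and var_bound: "\<forall>x y. Var2 B \<Xi> g gbar x y \<le> 2 * Lg * (lin_error f fbar gbar x y + \<delta>g)"
    and c: "0 < c1" "0 < c2" "0 < c3" "0 < c4"
    and requirement: "stepsize_requirement P \<Xi> g B f fbar gbar \<psi> \<delta>f Lf c1 c2 c3 c4 Mplus"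
    and x0: "x0 \<in> eff_dom \<psi>"
    and run: "universal_fast_sgd P \<Xi> g B \<psi> D Mplus x0 H \<zeta> x v y M"
begin

sublocale prob_space P by (rule prob)

text \<open>A real-valued stand-in for the objective, faithful only on the domain of \<psi>:
  elsewhere \<open>real_of_ereal\<close> turns infinity into 0.\<close>

definition F :: "real ^ 'n \<Rightarrow> real" where "F u = f u + real_of_ereal (\<psi> u)"

abbreviation \<beta> :: "real ^ 'n \<Rightarrow> real ^ 'n \<Rightarrow> real" where "\<beta> \<equiv> lin_error f fbar gbar"

text \<open>Shifted by one: this is the weight of the step from \<open>k\<close> to
  \<open>Suc k\<close>.\<close>

definition a :: "nat \<Rightarrow> real" where "a k = step_a (Suc k)"

definition gy :: "nat \<Rightarrow> 'w \<Rightarrow> real ^ 'n" where "gy k \<omega> = g (y k \<omega>) (\<zeta> (2 * k) \<omega>)"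

definition gx :: "nat \<Rightarrow> 'w \<Rightarrow> real ^ 'n" where "gx k \<omega> = g (x (Suc k) \<omega>) (\<zeta> (2 * k + 1) \<omega>)"

definition \<Omega> :: "nat \<Rightarrow> real" where "\<Omega> k = (a k)\<^sup>2 / (step_A (Suc k))\<^sup>2 * D\<^sup>2"

text \<open>Conversion factor between the coefficients of the potential and those of the update
  rule, which receives \<open>r k * M k\<close> and returns \<open>r k * M (Suc k)\<close>.\<close>

definition r :: "nat \<Rightarrow> real" where "r k = step_A (Suc k) / (a k)\<^sup>2"

definition Mhat :: "nat \<Rightarrow> 'w \<Rightarrow> real" where
  "Mhat k \<omega> = Mplus (r k * M k \<omega>) (\<Omega> k) (y k \<omega>) (x (Suc k) \<omega>) (gy k \<omega>) (gx k \<omega>)"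

definition X :: "nat \<Rightarrow> 'w \<Rightarrow> real" where
  "X k \<omega> = Delta_hat B f fbar gbar (y k \<omega>) (x (Suc k) \<omega>) (gy k \<omega>) (Mhat k \<omega>)
     + (Mhat k \<omega> - r k * M k \<omega>) * \<Omega> k + \<beta> (x (Suc k) \<omega>) (y k \<omega>)"

definition V :: "nat \<Rightarrow> 'w \<Rightarrow> real" where
  "V k \<omega> = Var B \<Xi> g gbar (x (Suc k) \<omega>) + Var B \<Xi> g gbar (y k \<omega>)"

definition potential :: "nat \<Rightarrow> 'w \<Rightarrow> real" where
  "potential k \<omega> = step_A k * (F (x k \<omega>) - F xstar) + M k \<omega> / 2 * (primal_norm B (v k \<omega> - xstar))\<^sup>2"

definition noise :: "nat \<Rightarrow> 'w \<Rightarrow> real" where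
  "noise k \<omega> = (gbar (y k \<omega>) - gy k \<omega>) \<bullet> (v k \<omega> - xstar)"

section \<open>Closed forms of the weights\<close>

lemma step_A_Suc: "step_A (Suc k) = step_A k + a k"
  by (simp add: step_A_def a_def)

lemma step_A_eq: "step_A k = real k * (real k + 1) / 4"
  by (induction k) (simp_all add: step_A_Suc a_def step_a_def step_A_def field_simps)

lemma a_eq: "a k = real (Suc k) / 2"
  by (simp add: a_def step_a_def)

lemma a_pos: "0 < a k"
  by (simp add: a_eq)

lemma step_A_nonneg: "0 \<le> step_A k"
  by (simp add: step_A_eq)

lemma step_A_Suc_pos: "0 < step_A (Suc k)"
  by (simp add: step_A_eq)

lemma r_pos: "0 < r k"
  using a_pos[of k] step_A_Suc_pos[of k] by (simp add: r_def)

lemma r_eq: "r k = (real (Suc k) + 1) / real (Suc k)"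
  by (simp add: r_def step_A_eq a_eq power2_eq_square field_simps del: of_nat_Suc)

text \<open>In units of the potential, the price of a unit increase of \<open>M\<close> is the same
  in every step. This independence of \<open>k\<close> lets the capped increments telescope.\<close>

lemma step_A_r_Omega: "step_A (Suc k) * (r k * \<Omega> k) = D\<^sup>2"
  using a_pos[of k] step_A_Suc_pos[of k] by (simp add: r_def \<Omega>_def field_simps power2_eq_square)

section \<open>Pathwise facts: feasibility, bounds on the domain, optimal value\<close>

lemma run_start:
  assumes "\<omega> \<in> space P"
  shows "x 0 \<omega> = x0" "v 0 \<omega> = x0" "M 0 \<omega> = 0"
  using run assms by (auto simp: universal_fast_sgd_def)

lemma run_step:
  assumes "\<omega> \<in> space P"
  shows "y k \<omega> = (step_A k / step_A (Suc k)) *\<^sub>R x k \<omega> + (a k / step_A (Suc k)) *\<^sub>R v k \<omega>"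
    and "v (Suc k) \<omega> \<in> Prox B \<psi> (v k \<omega>) (gy k \<omega>) (M k \<omega> / a k)"
    and "x (Suc k) \<omega> = (step_A k / step_A (Suc k)) *\<^sub>R x k \<omega> + (a k / step_A (Suc k)) *\<^sub>R v (Suc k) \<omega>"
    and "M (Suc k) \<omega> = (a k)\<^sup>2 / step_A (Suc k) * Mhat k \<omega>"
  using run assms unfolding universal_fast_sgd_def Let_def Mhat_def gx_def gy_def a_def r_def \<Omega>_def
  by blast+

lemma Mhat_eq: "\<omega> \<in> space P \<Longrightarrow> Mhat k \<omega> = r k * M (Suc k) \<omega>"
  using a_pos[of k] step_A_Suc_pos[of k] by (simp add: run_step(4) r_def)

lemma convex_dom: "convex (eff_dom \<psi>)"
  using convex_real_of_proper[OF \<psi>] by (simp add: convex_on_def)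

lemma xstar_dom: "xstar \<in> eff_dom \<psi>"
  using solution by (simp add: is_solution_def is_arg_min_def)

lemma weights:
  "0 \<le> step_A k / step_A (Suc k)" "0 \<le> a k / step_A (Suc k)"
  "step_A k / step_A (Suc k) + a k / step_A (Suc k) = 1"
  using step_A_nonneg[of k] a_pos[of k] step_A_Suc_pos[of k]
  by (simp_all add: step_A_Suc flip: add_divide_distrib)

lemma v_dom: "\<omega> \<in> space P \<Longrightarrow> v k \<omega> \<in> eff_dom \<psi>"
  using x0 run_step(2)[of \<omega>] by (cases k) (auto simp: run_start Prox_def is_arg_min_def)

lemma x_dom: "\<omega> \<in> space P \<Longrightarrow> x k \<omega> \<in> eff_dom \<psi>"
proof (induction k)
  case (Suc k)
  then show ?case
    using convexD[OF convex_dom _ _ weights] v_dom by (simp add: run_step(3))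
qed (use x0 in \<open>simp add: run_start\<close>)

lemma y_dom: "\<omega> \<in> space P \<Longrightarrow> y k \<omega> \<in> eff_dom \<psi>"
  using convexD[OF convex_dom x_dom v_dom weights] by (simp add: run_step(1))

lemma dist_le_D: "u \<in> eff_dom \<psi> \<Longrightarrow> w \<in> eff_dom \<psi> \<Longrightarrow> primal_norm B (u - w) \<le> D"
  using diam by blast

lemma dist_sq_le_D: "u \<in> eff_dom \<psi> \<Longrightarrow> w \<in> eff_dom \<psi> \<Longrightarrow> (primal_norm B (u - w))\<^sup>2 \<le> D\<^sup>2"
  using dist_le_D B by (intro power_mono) auto

lemma D_nonneg: "0 \<le> D"
  using dist_le_D[OF x0 x0] by simp

lemma \<beta>_nonneg: "0 \<le> \<beta> u w"
  using smooth by (simp add: approx_smooth_def)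

lemma \<delta>f_nonneg: "0 \<le> \<delta>f" and Lf_nonneg: "0 \<le> Lf"
  using smooth by (auto simp: approx_smooth_def)

lemma \<beta>_le: "u \<in> eff_dom \<psi> \<Longrightarrow> w \<in> eff_dom \<psi> \<Longrightarrow> \<beta> u w \<le> Lf / 2 * D\<^sup>2 + \<delta>f"
proof -
  assume "u \<in> eff_dom \<psi>" "w \<in> eff_dom \<psi>"
  then have "Lf / 2 * (primal_norm B (u - w))\<^sup>2 \<le> Lf / 2 * D\<^sup>2"
    using dist_sq_le_D Lf_nonneg by (intro mult_left_mono) auto
  then show ?thesis using smooth by (smt (verit) approx_smooth_def)
qed

lemma objective_eq: "u \<in> eff_dom \<psi> \<Longrightarrow> objective f \<psi> u = ereal (F u)"
  using proper_ereal_real[OF \<psi>] unfolding objective_def F_def by (metis plus_ereal.simps(1))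

lemma F_min: "u \<in> eff_dom \<psi> \<Longrightarrow> F xstar \<le> F u"
  using solution objective_eq[of u] objective_eq[OF xstar_dom]
  by (auto simp: is_solution_def is_arg_min_def not_less)

lemma optimal_value_eq: "optimal_value f \<psi> = ereal (F xstar)"
proof -
  have "optimal_value f \<psi> = objective f \<psi> xstar"
    unfolding optimal_value_def
    using xstar_dom F_min by (intro antisym INF_lower INF_greatest) (simp_all add: objective_eq)
  then show ?thesis by (simp add: objective_eq xstar_dom)
qed

section \<open>Measurability along the filtration\<close>

lemma subalg: "subalgebra P (H n)"
  using run by (simp add: universal_fast_sgd_def)

lemma subalg_mono: "m \<le> n \<Longrightarrow> subalgebra (H n) (H m)"
  using run by (auto simp: universal_fast_sgd_def subalgebra_def filtration_def)

lemma measurable_H_mono: "h \<in> measurable (H m) N \<Longrightarrow> m \<le> n \<Longrightarrow> h \<in> measurable (H n) N"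
  using measurable_from_subalg[OF subalg_mono] by blast

lemma measurable_H_P: "h \<in> measurable (H m) N \<Longrightarrow> h \<in> measurable P N"
  using measurable_from_subalg[OF subalg] by blast

lemma space_H: "space (H n) = space P"
  using subalg[of n] by (simp add: subalgebra_def)

lemma fresh: "fresh_copy P \<Xi> (H n) (\<zeta> n)" and \<zeta>_measurable: "\<zeta> n \<in> measurable (H (Suc n)) \<Xi>"
  using run by (auto simp: universal_fast_sgd_def)

lemma v_measurable_Suc: "v (Suc k) \<in> borel_measurable (H (2 * k + 1))"
  using run by (auto simp: universal_fast_sgd_def)

lemma v_measurable: "v k \<in> borel_measurable (H (2 * k))"
proof (cases k)
  case 0
  have "v 0 \<in> borel_measurable (H 0)"
    by (subst measurable_cong[of _ _ "\<lambda>_. x0"]) (auto simp: space_H run_start)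
  then show ?thesis using 0 by simp
next
  case (Suc j)
  then show ?thesis using measurable_H_mono[OF v_measurable_Suc[of j]] by simp
qed

lemma M_measurable: "M k \<in> borel_measurable (H (2 * k))"
proof (cases k)
  case 0
  have "M 0 \<in> borel_measurable (H 0)"
    by (subst measurable_cong[of _ _ "\<lambda>_. 0"]) (auto simp: space_H run_start)
  then show ?thesis using 0 by simp
next
  case (Suc j)
  then show ?thesis using run by (auto simp: universal_fast_sgd_def)
qed

lemma x_measurable_Suc_aux:
  assumes "x k \<in> borel_measurable (H (2 * k))"
  shows "x (Suc k) \<in> borel_measurable (H (2 * k + 1))"
proof -
  have [measurable]: "x k \<in> borel_measurable (H (2 * k + 1))"
    by (rule measurable_H_mono[OF assms]) simp
  note [measurable] = v_measurable_Suc[of k]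
  have "(\<lambda>\<omega>. (step_A k / step_A (Suc k)) *\<^sub>R x k \<omega> + (a k / step_A (Suc k)) *\<^sub>R v (Suc k) \<omega>)
      \<in> borel_measurable (H (2 * k + 1))"
    by measurable
  then show ?thesis
    by (subst measurable_cong[of "H (2 * k + 1)"]) (auto simp: space_H run_step(3))
qed

lemma x_measurable: "x k \<in> borel_measurable (H (2 * k))"
proof (induction k)
  case 0
  have "x 0 \<in> borel_measurable (H 0)"
    by (subst measurable_cong[of _ _ "\<lambda>_. x0"]) (auto simp: space_H run_start)
  then show ?case by simp
next
  case (Suc k)
  then show ?case using measurable_H_mono[OF x_measurable_Suc_aux[OF Suc]] by simp
qed

lemmas x_measurable_Suc = x_measurable_Suc_aux[OF x_measurable]

lemma y_measurable: "y k \<in> borel_measurable (H (2 * k))"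
proof -
  note [measurable] = v_measurable[of k] x_measurable[of k]
  have "(\<lambda>\<omega>. (step_A k / step_A (Suc k)) *\<^sub>R x k \<omega> + (a k / step_A (Suc k)) *\<^sub>R v k \<omega>)
      \<in> borel_measurable (H (2 * k))"
    by measurable
  then show ?thesis
    by (subst measurable_cong[of "H (2 * k)"]) (auto simp: space_H run_step(1))
qed

lemmas iterates_measurable [measurable] =
  measurable_H_P[OF x_measurable] measurable_H_P[OF v_measurable]
  measurable_H_P[OF y_measurable] measurable_H_P[OF M_measurable]

lemma gbar_measurable [measurable]: "gbar \<in> borel_measurable borel"
  by (rule unbiased_oracle_mean_measurable[OF g_oracle unbiased])

lemma f_measurable [measurable]: "f \<in> borel_measurable borel"
  using f_convex by (intro borel_measurable_continuous_onI convex_on_continuous) auto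

lemma \<psi>_measurable [measurable]: "\<psi> \<in> borel_measurable borel"
  by (rule proper_closed_convex_measurable[OF \<psi>])

lemma \<zeta>_measurable_P [measurable]: "\<zeta> n \<in> measurable P \<Xi>"
  by (rule measurable_H_P[OF \<zeta>_measurable])

lemma g_measurable [measurable]: "(\<lambda>p. g (fst p) (snd p)) \<in> borel_measurable (borel \<Otimes>\<^sub>M \<Xi>)"
  using g_oracle by (simp add: stochastic_oracle_def case_prod_beta')

lemma gy_measurable [measurable]: "gy k \<in> borel_measurable P"
proof -
  have "(\<lambda>\<omega>. (\<lambda>p. g (fst p) (snd p)) (y k \<omega>, \<zeta> (2 * k) \<omega>)) \<in> borel_measurable P"
    by measurable
  then show ?thesis by (simp add: gy_def[abs_def])
qed

lemma F_measurable [measurable]: "F \<in> borel_measurable borel"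
  unfolding F_def[abs_def] by measurable

lemma \<beta>_measurable [measurable]:
  "h \<in> borel_measurable N \<Longrightarrow> h' \<in> borel_measurable N \<Longrightarrow> (\<lambda>\<omega>. \<beta> (h \<omega>) (h' \<omega>)) \<in> borel_measurable N"
  unfolding lin_error_def
  by (intro borel_measurable_diff borel_measurable_inner measurable_compose[OF _ f_measurable]
      measurable_compose[OF _ fbar] measurable_compose[OF _ gbar_measurable])

text \<open>\<open>Mplus\<close> is an arbitrary function, so measurability is read off from
  \<open>M (Suc k)\<close>, of which \<open>Mhat k\<close> is a constant multiple on the
  space.\<close>

lemma Mhat_measurable [measurable]: "Mhat k \<in> borel_measurable P"
proof -
  have "(\<lambda>\<omega>. r k * M (Suc k) \<omega>) \<in> borel_measurable P" by measurable
  then show ?thesis by (subst measurable_cong[of P]) (auto simp: Mhat_eq)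
qed

lemma X_measurable [measurable]: "X k \<in> borel_measurable P"
  unfolding X_def[abs_def] Delta_hat_def by measurable

lemma V_measurable [measurable]: "V k \<in> borel_measurable P"
proof -
  note [measurable] = Var_measurable[OF B g_oracle unbiased]
  show ?thesis unfolding V_def[abs_def] by measurable
qed

section \<open>Variance bounds, integrability of the oracle error, and the noise\<close>

lemma integrable_bounded:
  fixes h :: "'w \<Rightarrow> real"
  assumes "h \<in> borel_measurable P" "\<And>\<omega>. \<omega> \<in> space P \<Longrightarrow> 0 \<le> h \<omega>" "\<And>\<omega>. \<omega> \<in> space P \<Longrightarrow> h \<omega> \<le> C"
  shows "integrable P h"
  using assms by (intro integrable_const_bound[of _ C]) auto

lemma \<beta>_integrable:
  "integrable P (\<lambda>\<omega>. \<beta> (y k \<omega>) xstar)" "integrable P (\<lambda>\<omega>. \<beta> (x (Suc k) \<omega>) (y k \<omega>))"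
  by (rule integrable_bounded[OF _ \<beta>_nonneg \<beta>_le], use x_dom y_dom xstar_dom in measurable)+

lemma Var_le: "Var B \<Xi> g gbar u \<le> 4 * Lg * (\<beta> u w + \<delta>g) + 2 * Var B \<Xi> g gbar w"
  using Var_le_Var2[OF B g_oracle finite_var, of u w] var_bound[rule_format, of u w] by simp

text \<open>The variance at \<open>x (Suc k)\<close> is compared with that at \<open>y k\<close>,
  and the latter with that at \<open>xstar\<close>, because these are the two \<beta>-terms gained
  in \<open>step_inequality\<close>. The variance at \<open>y k\<close> is thus counted three times,
  whence 12, 16 = 4 + 12 and 6.\<close>

lemma V_le:
  "V k \<omega> \<le> 4 * Lg * \<beta> (x (Suc k) \<omega>) (y k \<omega>) + 12 * Lg * \<beta> (y k \<omega>) xstar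
    + 16 * Lg * \<delta>g + 6 * Var B \<Xi> g gbar xstar"
  using Var_le[of "x (Suc k) \<omega>" "y k \<omega>"] Var_le[of "y k \<omega>" xstar]
  unfolding V_def by (simp add: algebra_simps)

lemma Var_dom_le:
  assumes "u \<in> eff_dom \<psi>"
  shows "Var B \<Xi> g gbar u \<le> 4 * Lg * (Lf / 2 * D\<^sup>2 + \<delta>f + \<delta>g) + 2 * Var B \<Xi> g gbar xstar"
proof -
  have "4 * Lg * (\<beta> u xstar + \<delta>g) \<le> 4 * Lg * (Lf / 2 * D\<^sup>2 + \<delta>f + \<delta>g)"
    using \<beta>_le[OF assms xstar_dom] Lg by (intro mult_left_mono) auto
  then show ?thesis using Var_le[of u xstar] by linarith
qed

lemma V_integrable: "integrable P (V k)"
proof (rule integrable_bounded)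
  show "V k \<omega> \<le> 2 * (4 * Lg * (Lf / 2 * D\<^sup>2 + \<delta>f + \<delta>g) + 2 * Var B \<Xi> g gbar xstar)"
    if "\<omega> \<in> space P" for \<omega>
    using Var_dom_le[OF x_dom[OF that, of "Suc k"]] Var_dom_le[OF y_dom[OF that, of k]]
    by (simp add: V_def)
qed (auto simp: V_def Var_nonneg)

lemma oracle_error_integrable: "integrable P (\<lambda>\<omega>. dual_norm B (gbar (y k \<omega>) - gy k \<omega>))"
proof -
  note [measurable] = dual_norm_measurable[OF B]
  let ?e = "\<lambda>\<omega>. dual_norm B (gbar (y k \<omega>) - gy k \<omega>)"
  have "dual_norm B (g (y k \<omega>) (\<zeta> (2 * k) \<omega>) - gbar (y k \<omega>)) = ?e \<omega>" for \<omega>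
    using dual_norm_minus[OF B, of "gbar (y k \<omega>) - gy k \<omega>"] by (simp add: gy_def)
  then have "integrable P (\<lambda>\<omega>. (?e \<omega>)\<^sup>2)"
    using fresh_query_square_integrable[OF prob B g_oracle unbiased finite_var subalg y_measurable fresh
        Var_dom_le[OF y_dom], of k] by simp
  then have "integrable P (\<lambda>\<omega>. (?e \<omega>)\<^sup>2 + 1)" by simp
  moreover have "\<bar>t\<bar> \<le> t\<^sup>2 + 1" for t :: real
    using sum_squares_bound[of "\<bar>t\<bar>" 1] by (simp add: power2_eq_square)
  ultimately show ?thesis
    by (intro Bochner_Integration.integrable_bound[of P "\<lambda>\<omega>. (?e \<omega>)\<^sup>2 + 1" ?e]) auto
qed

lemma oracle_error_inner_le:
  assumes "u \<in> eff_dom \<psi>" "w \<in> eff_dom \<psi>"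
  shows "\<bar>s \<bullet> (u - w)\<bar> \<le> dual_norm B s * D"
  using abs_inner_le_dual_primal[OF B, of s "u - w"] mult_left_mono[OF dist_le_D[OF assms], of "dual_norm B s"] B
  by simp

lemma noise_integrable: "integrable P (noise k)"
proof (rule Bochner_Integration.integrable_bound)
  show "integrable P (\<lambda>\<omega>. dual_norm B (gbar (y k \<omega>) - gy k \<omega>) * D)"
    using oracle_error_integrable by simp
  show "noise k \<in> borel_measurable P" unfolding noise_def[abs_def] by measurable
  show "AE \<omega> in P. norm (noise k \<omega>) \<le> norm (dual_norm B (gbar (y k \<omega>) - gy k \<omega>) * D)"
    using oracle_error_inner_le[OF v_dom xstar_dom] B D_nonneg
    by (auto simp: noise_def abs_mult intro!: AE_I2)
qed

text \<open>Both \<open>y k\<close> and \<open>v k\<close> are known before query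
  \<open>2 * k\<close>. With this pair frozen, the unbiased answer averages to
  \<open>gbar (y k)\<close>.\<close>

lemma noise_mean_zero: "(\<integral>\<omega>. noise k \<omega> \<partial>P) = 0"
proof -
  have \<Xi>: "prob_space \<Xi>" using g_oracle by (simp add: stochastic_oracle_def)
  interpret \<Xi>: prob_space \<Xi> by fact
  define h where "h = (\<lambda>p. (gbar (fst (fst p)) - g (fst (fst p)) (snd p)) \<bullet> (snd (fst p) - xstar))"
  note [measurable] = y_measurable[of k] v_measurable[of k]
  have [measurable]: "(\<lambda>p. g (fst (fst p)) (snd p)) \<in> borel_measurable ((borel \<Otimes>\<^sub>M borel) \<Otimes>\<^sub>M \<Xi>)"
    by (rule measurable_compose[OF _ g_measurable, of "\<lambda>p. (fst (fst p), snd p)", simplified]) measurable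
  have "(\<integral>\<omega>. h ((y k \<omega>, v k \<omega>), \<zeta> (2 * k) \<omega>) \<partial>P) = 0"
  proof (rule fresh_copy_integral_eq_0[OF prob \<Xi> subalg _ fresh])
    show "(\<lambda>\<omega>. (y k \<omega>, v k \<omega>)) \<in> measurable (H (2 * k)) (borel \<Otimes>\<^sub>M borel)"
      by measurable
    show "h \<in> borel_measurable ((borel \<Otimes>\<^sub>M borel) \<Otimes>\<^sub>M \<Xi>)"
      unfolding h_def by measurable
    show "integrable P (\<lambda>\<omega>. h ((y k \<omega>, v k \<omega>), \<zeta> (2 * k) \<omega>))"
      using noise_integrable[of k] by (simp add: h_def noise_def[abs_def] gy_def)
    show "(\<integral>s. h (p, s) \<partial>\<Xi>) = 0" for p
      using unbiased by (simp add: h_def unbiased_oracle_def \<Xi>.prob_space)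
  qed
  then show ?thesis by (simp add: h_def noise_def[abs_def] gy_def)
qed

subsection \<open>Expected decrease of the potential and the rate\<close>

text \<open>\<open>0 < D\<close> makes \<open>\<Omega> k\<close> positive, as the requirement
  demands. Nonnegativity of \<open>M k\<close> is a premise because it is itself proved by induction
  from the monotonicity obtained here.\<close>

lemma requirement_at:
  assumes D: "0 < D" and M_nonneg: "\<And>\<omega>. \<omega> \<in> space P \<Longrightarrow> 0 \<le> M k \<omega>"
  shows "\<And>\<omega>. \<omega> \<in> space P \<Longrightarrow> r k * M k \<omega> \<le> Mhat k \<omega>"
    and "\<And>Mbar. c2 * Lf < Mbar \<Longrightarrow> integrable P (\<lambda>\<omega>. max 0 (- X k \<omega>)) \<Longrightarrow> integrable P (X k) \<and>
      (\<integral>\<omega>. X k \<omega> \<partial>P) \<le> c1 / (Mbar - c2 * Lf) * (\<integral>\<omega>. V k \<omega> \<partial>P) + c3 * \<delta>f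
        + c4 * (\<integral>\<omega>. max 0 (min (Mhat k \<omega>) Mbar - r k * M k \<omega>) * \<Omega> k \<partial>P)"
proof -
  have \<Omega>: "0 < \<Omega> k"
    using D a_pos[of k] step_A_Suc_pos[of k] by (simp add: \<Omega>_def)
  have sub: "subalgebra (H (2 * k + 1)) (H (2 * k))" by (rule subalg_mono) simp
  have \<zeta>: "\<zeta> (2 * k) \<in> measurable (H (2 * k + 1)) \<Xi>" using \<zeta>_measurable[of "2 * k"] by simp
  have m: "(\<lambda>\<omega>. r k * M k \<omega>) \<in> borel_measurable (H (2 * k + 1))"
    using measurable_H_mono[OF M_measurable[of k], of "2 * k + 1"] by simp
  have nonneg: "\<forall>\<omega>\<in>space P. 0 \<le> r k * M k \<omega>" using M_nonneg r_pos[of k] by simp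
  have dom: "\<forall>\<omega>\<in>space P. y k \<omega> \<in> eff_dom \<psi>" "\<forall>\<omega>\<in>space P. x (Suc k) \<omega> \<in> eff_dom \<psi>"
    using x_dom y_dom by auto
  note req = requirement[unfolded stepsize_requirement_def Let_def, rule_format (no_asm),
      OF \<Omega> subalg sub y_measurable dom(1) fresh \<zeta> m nonneg x_measurable_Suc dom(2) fresh]
  note req' = req[folded gy_def gx_def, folded Mhat_def, folded X_def V_def]
  show "r k * M k \<omega> \<le> Mhat k \<omega>" if "\<omega> \<in> space P" for \<omega>
    using req' that by blast
  show "integrable P (X k) \<and>
      (\<integral>\<omega>. X k \<omega> \<partial>P) \<le> c1 / (Mbar - c2 * Lf) * (\<integral>\<omega>. V k \<omega> \<partial>P) + c3 * \<delta>f
        + c4 * (\<integral>\<omega>. max 0 (min (Mhat k \<omega>) Mbar - r k * M k \<omega>) * \<Omega> k \<partial>P)"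
    if "c2 * Lf < Mbar" "integrable P (\<lambda>\<omega>. max 0 (- X k \<omega>))" for Mbar
    using req'[THEN conjunct2, rule_format, OF that(1) Mhat_measurable X_measurable that(2) V_integrable] .
qed

lemma M_nonneg:
  assumes "0 < D" "\<omega> \<in> space P"
  shows "0 \<le> M k \<omega>"
  using assms(2)
proof (induction k arbitrary: \<omega>)
  case (Suc k)
  have "0 \<le> r k * M k \<omega>" using Suc r_pos[of k] by simp
  also have "\<dots> \<le> Mhat k \<omega>" using Suc by (intro requirement_at(1) assms(1))
  finally show ?case using a_pos[of k] step_A_Suc_pos[of k] Suc.prems by (simp add: run_step(4))
qed (simp add: run_start)

lemma Mhat_ge: "0 < D \<Longrightarrow> \<omega> \<in> space P \<Longrightarrow> r k * M k \<omega> \<le> Mhat k \<omega>"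
  by (intro requirement_at(1) M_nonneg)

lemma M_mono: "0 < D \<Longrightarrow> \<omega> \<in> space P \<Longrightarrow> M k \<omega> \<le> M (Suc k) \<omega>"
  using Mhat_ge[of \<omega> k] r_pos[of k] by (simp add: Mhat_eq)

text \<open>This is \<open>accelerated_step\<close> at \<open>z = xstar\<close>. The nonnegative
  gain at \<open>x k\<close> is dropped; the other two gains are kept to pay for the
  variances.\<close>

lemma step_inequality:
  assumes D: "0 < D" and \<omega>: "\<omega> \<in> space P"
  shows "potential (Suc k) \<omega> + a k * \<beta> (y k \<omega>) xstar + step_A (Suc k) * \<beta> (x (Suc k) \<omega>) (y k \<omega>)
    \<le> potential k \<omega> + a k * noise k \<omega> + step_A (Suc k) * X k \<omega>"
proof -
  have "potential (Suc k) \<omega> + step_A k * \<beta> (y k \<omega>) (x k \<omega>) + a k * \<beta> (y k \<omega>) xstar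
      + step_A (Suc k) * \<beta> (x (Suc k) \<omega>) (y k \<omega>)
    \<le> potential k \<omega> + a k * noise k \<omega> + step_A (Suc k) * X k \<omega>"
    unfolding potential_def noise_def X_def step_A_Suc \<Omega>_def F_def
    by (rule accelerated_step[OF B \<psi> a_pos step_A_nonneg x_dom[OF \<omega>] xstar_dom
          run_step(1)[OF \<omega>, unfolded step_A_Suc] run_step(2)[OF \<omega>]
          run_step(3)[OF \<omega>, unfolded step_A_Suc] _ run_step(4)[OF \<omega>, unfolded step_A_Suc]
          Mhat_ge[OF D \<omega>] dist_le_D[OF v_dom[OF \<omega>] v_dom[OF \<omega>]]
          dist_le_D[OF v_dom[OF \<omega>] xstar_dom]])
      (simp add: r_def step_A_Suc)
  moreover have "0 \<le> step_A k * \<beta> (y k \<omega>) (x k \<omega>)"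
    by (intro mult_nonneg_nonneg step_A_nonneg \<beta>_nonneg)
  ultimately show ?thesis by linarith
qed

section \<open>Integrability of stepsizes and objective values\<close>

lemma x_step_sq_le:
  assumes \<omega>: "\<omega> \<in> space P"
  shows "(primal_norm B (x (Suc k) \<omega> - y k \<omega>))\<^sup>2 \<le> \<Omega> k"
proof -
  have "x (Suc k) \<omega> - y k \<omega> = (a k / step_A (Suc k)) *\<^sub>R (v (Suc k) \<omega> - v k \<omega>)"
    using \<omega> by (simp add: run_step(1,3) scaleR_diff_right)
  then have "(primal_norm B (x (Suc k) \<omega> - y k \<omega>))\<^sup>2
      = (a k / step_A (Suc k))\<^sup>2 * (primal_norm B (v (Suc k) \<omega> - v k \<omega>))\<^sup>2"
    by (simp add: primal_norm_scaleR B power_mult_distrib power_divide)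
  also have "\<dots> \<le> (a k / step_A (Suc k))\<^sup>2 * D\<^sup>2"
    by (intro mult_left_mono dist_sq_le_D v_dom \<omega>) auto
  finally show ?thesis by (simp add: \<Omega>_def power_divide)
qed

text \<open>The squared displacement is at most \<open>\<Omega> k\<close>, so the quadratic term of
  \<open>Delta_hat\<close> uses up only half of \<open>Mhat k * \<Omega> k\<close>. The other half
  survives and lets \<open>X k\<close> control \<open>Mhat k\<close>.\<close>

lemma X_lower:
  assumes D: "0 < D" and \<omega>: "\<omega> \<in> space P"
  shows "Mhat k \<omega> * \<Omega> k / 2 - r k * M k \<omega> * \<Omega> k - dual_norm B (gbar (y k \<omega>) - gy k \<omega>) * D \<le> X k \<omega>"
proof -
  have "0 \<le> Mhat k \<omega>"
    using M_nonneg[OF D \<omega>] r_pos[of k] \<omega> by (simp add: Mhat_eq)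
  then have "Mhat k \<omega> / 2 * (primal_norm B (x (Suc k) \<omega> - y k \<omega>))\<^sup>2 \<le> Mhat k \<omega> / 2 * \<Omega> k"
    by (intro mult_left_mono x_step_sq_le \<omega>) auto
  then show ?thesis
    using oracle_error_inner_le[OF x_dom[OF \<omega>] y_dom[OF \<omega>], of "gbar (y k \<omega>) - gy k \<omega>" "Suc k" k]
      \<beta>_nonneg[of "y k \<omega>" "x (Suc k) \<omega>"] \<beta>_nonneg[of "x (Suc k) \<omega>" "y k \<omega>"]
    by (simp add: X_def Delta_hat_def left_diff_distrib)
qed

text \<open>By \<open>X_lower\<close> the negative part of \<open>X k\<close> is dominated using
  only \<open>M k\<close> and the oracle error. This is the premise under which the requirement
  delivers integrability of \<open>X k\<close> itself.\<close>

lemma X_integrable_aux: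
  assumes D: "0 < D" and M: "integrable P (M k)"
  shows "integrable P (\<lambda>\<omega>. max 0 (- X k \<omega>))"
proof (rule Bochner_Integration.integrable_bound)
  let ?h = "\<lambda>\<omega>. r k * M k \<omega> * \<Omega> k + dual_norm B (gbar (y k \<omega>) - gy k \<omega>) * D"
  show "integrable P ?h" using M oracle_error_integrable[of k] by simp
  have "norm (max 0 (- X k \<omega>)) \<le> norm (?h \<omega>)" if \<omega>: "\<omega> \<in> space P" for \<omega>
  proof -
    have "0 \<le> \<Omega> k" using x_step_sq_le[OF \<omega>, of k] by (meson order_trans zero_le_power2)
    moreover have "0 \<le> Mhat k \<omega>" "0 \<le> r k * M k \<omega>"
      using M_nonneg[OF D \<omega>] r_pos[of k] \<omega> by (simp_all add: Mhat_eq)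
    moreover have "0 \<le> dual_norm B (gbar (y k \<omega>) - gy k \<omega>) * D" using B D by simp
    ultimately show ?thesis
      using X_lower[OF D \<omega>, of k] by (smt (verit) mult_nonneg_nonneg divide_nonneg_pos real_norm_def)
  qed
  then show "AE \<omega> in P. norm (max 0 (- X k \<omega>)) \<le> norm (?h \<omega>)" by (rule AE_I2)
qed measurable

lemma X_integrable:
  assumes D: "0 < D" and M: "integrable P (M k)"
  shows "integrable P (X k)"
  \<comment> \<open>Integrability does not mention the cap, so any admissible value serves.\<close>
  using requirement_at(2)[OF D M_nonneg[OF D] _ X_integrable_aux[OF D M], of "c2 * Lf + 1"] by simp

text \<open>Induction passing through \<open>X\<close>: integrability of \<open>M k\<close> gives
  that of \<open>X k\<close>, and \<open>X_lower\<close>, solved for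
  \<open>Mhat k = r k * M (Suc k)\<close>, then dominates the next coefficient.\<close>

lemma M_integrable:
  assumes D: "0 < D"
  shows "integrable P (M k)"
proof (induction k)
  case 0
  have "integrable P (\<lambda>_. 0 :: real)" by simp
  then show ?case
    by (subst Bochner_Integration.integrable_cong[OF refl, of _ _ "\<lambda>_. 0"]) (auto simp: run_start)
next
  case (Suc k)
  have \<Omega>: "0 < \<Omega> k"
    using D a_pos[of k] step_A_Suc_pos[of k] by (simp add: \<Omega>_def)
  let ?h = "\<lambda>\<omega>. 2 / (r k * \<Omega> k) * (X k \<omega> + r k * M k \<omega> * \<Omega> k + dual_norm B (gbar (y k \<omega>) - gy k \<omega>) * D)"
  have "integrable P ?h"
    using X_integrable[OF D Suc] Suc oracle_error_integrable[of k] by simp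
  moreover have "norm (M (Suc k) \<omega>) \<le> norm (?h \<omega>)" if \<omega>: "\<omega> \<in> space P" for \<omega>
  proof -
    have "M (Suc k) \<omega> * (r k * \<Omega> k) \<le> 2 * (X k \<omega> + r k * M k \<omega> * \<Omega> k + dual_norm B (gbar (y k \<omega>) - gy k \<omega>) * D)"
      using X_lower[OF D \<omega>, of k] by (simp add: Mhat_eq \<omega> mult.commute mult.left_commute)
    then have "M (Suc k) \<omega> \<le> ?h \<omega>"
      using r_pos[of k] \<Omega> by (simp add: pos_le_divide_eq)
    then show ?thesis using M_nonneg[OF D \<omega>, of "Suc k"] unfolding real_norm_def by linarith
  qed
  ultimately show ?case
    by (intro Bochner_Integration.integrable_bound[of P ?h "M (Suc k)"] AE_I2) measurable
qed

lemma weighted_distance_integrable: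
  assumes D: "0 < D"
  shows "integrable P (\<lambda>\<omega>. M k \<omega> / 2 * (primal_norm B (v k \<omega> - xstar))\<^sup>2)"
proof (rule Bochner_Integration.integrable_bound)
  show "integrable P (\<lambda>\<omega>. M k \<omega> / 2 * D\<^sup>2)" using M_integrable[OF D] by simp
  have "norm (M k \<omega> / 2 * (primal_norm B (v k \<omega> - xstar))\<^sup>2) \<le> norm (M k \<omega> / 2 * D\<^sup>2)"
    if "\<omega> \<in> space P" for \<omega>
    using M_nonneg[OF D that, of k] dist_sq_le_D[OF v_dom[OF that] xstar_dom, of k]
    by (auto simp: abs_mult intro!: mult_left_mono)
  then show "AE \<omega> in P. norm (M k \<omega> / 2 * (primal_norm B (v k \<omega> - xstar))\<^sup>2) \<le> norm (M k \<omega> / 2 * D\<^sup>2)"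
    by (rule AE_I2)
qed measurable

text \<open>Since \<psi> may be unbounded above on its domain, feasibility alone gives no upper
  bound. Instead the weighted gap, nonnegative by optimality of \<open>xstar\<close>, is dominated
  by the right-hand side of \<open>step_inequality\<close>, starting from a constant.\<close>

lemma F_integrable:
  assumes D: "0 < D"
  shows "integrable P (\<lambda>\<omega>. F (x k \<omega>))"
proof (induction k)
  case 0
  have "integrable P (\<lambda>_. F x0)" by simp
  then show ?case
    by (subst Bochner_Integration.integrable_cong[OF refl, of _ _ "\<lambda>_. F x0"]) (auto simp: run_start)
next
  case (Suc k)
  let ?h = "\<lambda>\<omega>. potential k \<omega> + a k * noise k \<omega> + step_A (Suc k) * X k \<omega>"
  let ?u = "\<lambda>\<omega>. step_A (Suc k) * (F (x (Suc k) \<omega>) - F xstar)"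
  have "integrable P ?h"
    using Suc weighted_distance_integrable[OF D, of k] noise_integrable[of k]
      X_integrable[OF D M_integrable[OF D], of k]
    unfolding potential_def by simp
  moreover have "norm (?u \<omega>) \<le> norm (?h \<omega>)" if \<omega>: "\<omega> \<in> space P" for \<omega>
  proof -
    have "0 \<le> ?u \<omega>" using F_min[OF x_dom[OF \<omega>]] step_A_nonneg by simp
    moreover have "?u \<omega> \<le> potential (Suc k) \<omega>"
      using M_nonneg[OF D \<omega>] by (simp add: potential_def)
    moreover have "0 \<le> a k * \<beta> (y k \<omega>) xstar" "0 \<le> step_A (Suc k) * \<beta> (x (Suc k) \<omega>) (y k \<omega>)"
      using a_pos[of k] step_A_nonneg \<beta>_nonneg by simp_all
    ultimately show ?thesis using step_inequality[OF D \<omega>, of k] by simp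
  qed
  ultimately have "integrable P ?u"
    by (intro Bochner_Integration.integrable_bound[of P ?h ?u] AE_I2) measurable
  then have "integrable P (\<lambda>\<omega>. F (x (Suc k) \<omega>) - F xstar)" using step_A_Suc_pos[of k] by simp
  from Bochner_Integration.integrable_add[OF this, of "\<lambda>_. F xstar"] show ?case by simp
qed

lemma potential_integrable:
  assumes D: "0 < D"
  shows "integrable P (potential k)"
  unfolding potential_def[abs_def]
  using F_integrable[OF D] weighted_distance_integrable[OF D] by simp

section \<open>Telescoping the descent inequality in expectation\<close>

lemma min_M_integrable: "0 < D \<Longrightarrow> integrable P (\<lambda>\<omega>. min (M k \<omega>) C)"
  using M_integrable by simp

text \<open>If \<open>M k\<close> exceeds \<open>C\<close>, both sides vanish; otherwise
  monotonicity of \<open>M\<close> makes the positive part inactive. The common factor becomes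
  \<open>D\<^sup>2\<close> by \<open>step_A_r_Omega\<close>.\<close>

lemma truncated_increment:
  assumes D: "0 < D" and \<omega>: "\<omega> \<in> space P"
  shows "step_A (Suc k) * (max 0 (min (Mhat k \<omega>) (r k * C) - r k * M k \<omega>) * \<Omega> k)
    = D\<^sup>2 * (min (M (Suc k) \<omega>) C - min (M k \<omega>) C)"
proof -
  have "min (Mhat k \<omega>) (r k * C) = r k * min (M (Suc k) \<omega>) C"
    using r_pos[of k] by (simp add: Mhat_eq[OF \<omega>] min_def)
  moreover have "max 0 (min (M (Suc k) \<omega>) C - M k \<omega>) = min (M (Suc k) \<omega>) C - min (M k \<omega>) C"
    using M_mono[OF D \<omega>, of k] by (simp add: min_def max_def)
  moreover have "max 0 (r k * t) = r k * max 0 t" for t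
    using r_pos[of k] by (simp add: max_def zero_le_mult_iff mult_le_0_iff)
  ultimately have "max 0 (min (Mhat k \<omega>) (r k * C) - r k * M k \<omega>)
      = r k * (min (M (Suc k) \<omega>) C - min (M k \<omega>) C)"
    by (metis right_diff_distrib)
  then show ?thesis using step_A_r_Omega[of k] by (simp add: mult.assoc mult.left_commute)
qed

text \<open>The cap on the stepsize coefficient is \<open>r k * C\<close> for a fixed \<open>C\<close>: this is what makes the
  capped increments telescope. The excess \<open>\<mu>\<close> of \<open>C\<close> over \<open>c2 * Lf\<close> is so large that the
  \<open>\<beta>\<close>-part of the variances is absorbed by the \<open>\<beta>\<close>-terms that the descent inequality gains.\<close>

lemma expected_step:
  assumes D: "0 < D" and \<mu>: "0 < \<mu>" "6 * c1 * Lg * real (Suc k) \<le> \<mu>"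
  defines "C \<equiv> c2 * Lf + \<mu>"
  shows "expectation (potential (Suc k)) \<le> expectation (potential k) + 4 / 3 * a k * \<delta>g
    + 3 / 2 * (c1 * Var B \<Xi> g gbar xstar / \<mu>) * (real (Suc k))\<^sup>2 + step_A (Suc k) * c3 * \<delta>f
    + c4 * D\<^sup>2 * (expectation (\<lambda>\<omega>. min (M (Suc k) \<omega>) C) - expectation (\<lambda>\<omega>. min (M k \<omega>) C))"
proof -
  define n where "n = real (Suc k)"
  define A' where "A' = step_A (Suc k)"
  define \<alpha> where "\<alpha> = c1 / (r k * C - c2 * Lf)"
  define s where "s = Var B \<Xi> g gbar xstar"
  define b1 where "b1 = expectation (\<lambda>\<omega>. \<beta> (x (Suc k) \<omega>) (y k \<omega>))"
  define b2 where "b2 = expectation (\<lambda>\<omega>. \<beta> (y k \<omega>) xstar)"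
  have n: "1 \<le> n" by (simp add: n_def)
  have A': "A' = n * (n + 1) / 4" and ak: "a k = n / 2" and rk: "r k = (n + 1) / n"
    by (simp_all add: A'_def n_def step_A_eq a_eq r_eq)
  have b: "0 \<le> b1" "0 \<le> b2"
    unfolding b1_def b2_def by (intro integral_nonneg_AE AE_I2 \<beta>_nonneg)+
  have s: "0 \<le> s" by (simp add: s_def Var_nonneg)

  \<comment> \<open>As \<open>r k\<close> is at least 1, scaling \<open>C\<close> by it costs
    nothing on the part \<open>c2 * Lf\<close> and multiplies the excess \<mu> by
    \<open>r k\<close>.\<close>
  have gap: "(n + 1) / n * \<mu> \<le> r k * C - c2 * Lf"
  proof -
    have "1 \<le> r k" using n by (simp add: rk)
    then have "c2 * Lf \<le> r k * (c2 * Lf)"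
      using c Lf_nonneg mult_right_mono[of 1 "r k" "c2 * Lf"] by simp
    then show ?thesis by (simp add: C_def rk distrib_left)
  qed
  have gap_pos: "0 < (n + 1) / n * \<mu>" using n \<mu> by simp
  then have cap: "c2 * Lf < r k * C" using gap by linarith
  have \<alpha>: "0 < \<alpha>" using cap c by (simp add: \<alpha>_def)
  \<comment> \<open>The factor \<open>n + 1\<close> of \<open>A'\<close> cancels against that of
    \<open>r k\<close>.\<close>
  have A\<alpha>: "A' * \<alpha> \<le> c1 * n\<^sup>2 / (4 * \<mu>)"
  proof -
    have "\<alpha> \<le> c1 / ((n + 1) / n * \<mu>)"
      unfolding \<alpha>_def using gap cap c by (intro divide_left_mono mult_pos_pos[OF _ gap_pos]) auto
    then have "A' * \<alpha> \<le> A' * (c1 / ((n + 1) / n * \<mu>))"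
      using n by (intro mult_left_mono) (simp_all add: A')
    also have "\<dots> = c1 * n\<^sup>2 / (4 * \<mu>)"
      using n \<mu>(1) by (simp add: A' power2_eq_square divide_simps)
    finally show ?thesis .
  qed
  \<comment> \<open>Here 12 \<open>Lg\<close> is the coefficient of the \<beta>-term at
    \<open>xstar\<close> in \<open>V_le\<close>; the lower bound on \<mu> is exactly what makes its
    cost at most \<open>a k = n / 2\<close>.\<close>
  have A\<alpha>L: "A' * \<alpha> * (12 * Lg) \<le> a k"
  proof -
    have "A' * \<alpha> * (12 * Lg) \<le> c1 * n\<^sup>2 / (4 * \<mu>) * (12 * Lg)"
      using A\<alpha> Lg by (intro mult_right_mono) auto
    also have "\<dots> = (6 * c1 * Lg * n) * n / (2 * \<mu>)" by (simp add: power2_eq_square)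
    also have "\<dots> \<le> \<mu> * n / (2 * \<mu>)"
      using \<mu> n by (intro divide_right_mono mult_right_mono) (auto simp: n_def)
    also have "\<dots> = a k" using \<mu> by (simp add: ak)
    finally show ?thesis .
  qed

  have EV: "expectation (V k) \<le> 4 * Lg * b1 + 12 * Lg * b2 + 16 * Lg * \<delta>g + 6 * s"
  proof -
    have "expectation (V k) \<le> expectation (\<lambda>\<omega>. 4 * Lg * \<beta> (x (Suc k) \<omega>) (y k \<omega>)
        + 12 * Lg * \<beta> (y k \<omega>) xstar + (16 * Lg * \<delta>g + 6 * s))"
      using \<beta>_integrable[of k] V_le[of k]
      by (intro integral_mono V_integrable Bochner_Integration.integrable_add integrable_mult_right)
        (auto simp: s_def add.assoc)
    also have "\<dots> = 4 * Lg * b1 + 12 * Lg * b2 + (16 * Lg * \<delta>g + 6 * s)"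
      using \<beta>_integrable[of k] by (simp add: b1_def b2_def prob_space)
    finally show ?thesis by simp
  qed
  have "A' * \<alpha> * expectation (V k) \<le> A' * b1 + a k * b2 + 4 / 3 * a k * \<delta>g + 3 / 2 * (c1 * s / \<mu>) * n\<^sup>2"
  proof -
    let ?q = "A' * \<alpha> * (12 * Lg)"
    have q: "?q \<le> a k" by (rule A\<alpha>L)
    have "a k \<le> 3 * A'"
      using n mult_mono[of 2 "n + 1" n n] by (simp add: A' ak)
    with q have q3: "?q / 3 \<le> A'" by linarith
    have "A' * \<alpha> * expectation (V k) \<le> A' * \<alpha> * (4 * Lg * b1 + 12 * Lg * b2 + 16 * Lg * \<delta>g + 6 * s)"
      using EV \<alpha> n by (intro mult_left_mono) (simp_all add: A')
    \<comment> \<open>All terms with \<open>Lg\<close> are multiples of the same \<open>?q\<close>,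
      as 4 = 12 / 3 and 16 = 4 / 3 * 12. The latter produces the 4 / 3 in front of \<delta>g in the
      final rate.\<close>
    also have "\<dots> = ?q / 3 * b1 + ?q * b2 + 4 / 3 * ?q * \<delta>g + 6 * (A' * \<alpha>) * s"
      by (simp add: algebra_simps)
    also have "\<dots> \<le> A' * b1 + a k * b2 + 4 / 3 * a k * \<delta>g + 6 * (c1 * n\<^sup>2 / (4 * \<mu>)) * s"
      using q q3 b \<delta>g s A\<alpha> by (intro add_mono mult_right_mono mult_left_mono) auto
    finally show ?thesis by (simp add: mult_ac)
  qed
  moreover have "A' * (\<integral>\<omega>. max 0 (min (Mhat k \<omega>) (r k * C) - r k * M k \<omega>) * \<Omega> k \<partial>P)
      = D\<^sup>2 * (expectation (\<lambda>\<omega>. min (M (Suc k) \<omega>) C) - expectation (\<lambda>\<omega>. min (M k \<omega>) C))"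
  proof -
    have "A' * (\<integral>\<omega>. max 0 (min (Mhat k \<omega>) (r k * C) - r k * M k \<omega>) * \<Omega> k \<partial>P)
        = (\<integral>\<omega>. A' * (max 0 (min (Mhat k \<omega>) (r k * C) - r k * M k \<omega>) * \<Omega> k) \<partial>P)"
      by (rule integral_mult_right_zero[symmetric])
    also have "\<dots> = (\<integral>\<omega>. D\<^sup>2 * (min (M (Suc k) \<omega>) C - min (M k \<omega>) C) \<partial>P)"
      by (intro Bochner_Integration.integral_cong refl) (simp only: A'_def truncated_increment[OF D])
    also have "\<dots> = D\<^sup>2 * (\<integral>\<omega>. min (M (Suc k) \<omega>) C - min (M k \<omega>) C \<partial>P)"
      by (rule integral_mult_right_zero)
    finally show ?thesis
      using min_M_integrable[OF D] by (simp add: Bochner_Integration.integral_diff)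
  qed
  moreover have "A' * expectation (X k) \<le> A' * \<alpha> * expectation (V k) + A' * c3 * \<delta>f
      + c4 * (A' * (\<integral>\<omega>. max 0 (min (Mhat k \<omega>) (r k * C) - r k * M k \<omega>) * \<Omega> k \<partial>P))"
  proof -
    have "expectation (X k) \<le> \<alpha> * expectation (V k) + c3 * \<delta>f
        + c4 * (\<integral>\<omega>. max 0 (min (Mhat k \<omega>) (r k * C) - r k * M k \<omega>) * \<Omega> k \<partial>P)"
      unfolding \<alpha>_def
      using requirement_at(2)[OF D M_nonneg[OF D] cap X_integrable_aux[OF D M_integrable[OF D]]] by blast
    then have "A' * expectation (X k) \<le> A' * (\<alpha> * expectation (V k) + c3 * \<delta>f
        + c4 * (\<integral>\<omega>. max 0 (min (Mhat k \<omega>) (r k * C) - r k * M k \<omega>) * \<Omega> k \<partial>P))"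
      using n by (intro mult_left_mono) (simp_all add: A')
    then show ?thesis by (simp add: distrib_left mult_ac)
  qed
  moreover have "expectation (potential (Suc k)) + a k * b2 + A' * b1
      \<le> expectation (potential k) + A' * expectation (X k)"
  proof -
    note int = potential_integrable[OF D] \<beta>_integrable[of k] noise_integrable[of k]
      X_integrable[OF D M_integrable[OF D], of k]
    have "expectation (\<lambda>\<omega>. potential (Suc k) \<omega> + a k * \<beta> (y k \<omega>) xstar + A' * \<beta> (x (Suc k) \<omega>) (y k \<omega>))
      \<le> expectation (\<lambda>\<omega>. potential k \<omega> + a k * noise k \<omega> + A' * X k \<omega>)"
      unfolding A'_def using int
      by (intro integral_mono step_inequality D Bochner_Integration.integrable_add integrable_mult_right)
    then show ?thesis using int by (simp add: b1_def b2_def noise_mean_zero)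
  qed
  ultimately show ?thesis by (simp add: A'_def n_def s_def)
qed

text \<open>One \<mu> meets the lower bounds of all steps up to \<open>K\<close>, so
  \<open>C\<close> is fixed and the truncated coefficients telescope; they start at 0 because
  \<open>M 0 = 0\<close> and \<open>C\<close> is nonnegative. The cubic polynomials are the sums of
  3 / 2 times the squares and of the weights \<open>step_A\<close>.\<close>

lemma expected_potential:
  assumes D: "0 < D" and \<mu>: "0 < \<mu>" "6 * c1 * Lg * real K \<le> \<mu>" and "j \<le> K"
  defines "C \<equiv> c2 * Lf + \<mu>"
  shows "expectation (potential j) \<le> 4 / 3 * step_A j * \<delta>g
    + (c1 * Var B \<Xi> g gbar xstar / \<mu>) * (real j * (real j + 1) * (2 * real j + 1) / 4)
    + c3 * \<delta>f * (real j * (real j + 1) * (real j + 2) / 12)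
    + c4 * D\<^sup>2 * expectation (\<lambda>\<omega>. min (M j \<omega>) C)"
  using \<open>j \<le> K\<close>
proof (induction j)
  case 0
  have C: "0 \<le> C" using c Lf_nonneg \<mu> by (simp add: C_def)
  have "expectation (potential 0) = expectation (\<lambda>_. 0)"
    by (intro Bochner_Integration.integral_cong refl) (simp add: potential_def run_start step_A_def)
  moreover have "expectation (\<lambda>\<omega>. min (M 0 \<omega>) C) = expectation (\<lambda>_. 0)"
    using C by (intro Bochner_Integration.integral_cong refl) (simp add: run_start)
  ultimately show ?case by (simp add: step_A_def)
next
  case (Suc j)
  have "6 * c1 * Lg * real (Suc j) \<le> 6 * c1 * Lg * real K"
    using c Lg Suc.prems by (intro mult_left_mono) auto
  then have "6 * c1 * Lg * real (Suc j) \<le> \<mu>" using \<mu> by linarith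
  note step = expected_step[OF D \<mu>(1) this, folded C_def]
  have "real (Suc j) * (real (Suc j) + 1) * (2 * real (Suc j) + 1) / 4
      = real j * (real j + 1) * (2 * real j + 1) / 4 + 3 / 2 * (real (Suc j))\<^sup>2"
    by (simp add: power2_eq_square field_simps)
  then have sq: "t * (real (Suc j) * (real (Suc j) + 1) * (2 * real (Suc j) + 1) / 4)
      = t * (real j * (real j + 1) * (2 * real j + 1) / 4) + 3 / 2 * t * (real (Suc j))\<^sup>2" for t
    by (simp only: distrib_left)
  have "real (Suc j) * (real (Suc j) + 1) * (real (Suc j) + 2) / 12
      = real j * (real j + 1) * (real j + 2) / 12 + step_A (Suc j)"
    by (simp add: step_A_eq field_simps)
  then have cu: "t * (real (Suc j) * (real (Suc j) + 1) * (real (Suc j) + 2) / 12)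
      = t * (real j * (real j + 1) * (real j + 2) / 12) + step_A (Suc j) * t" for t
    by (simp only: distrib_left mult.commute)
  have "4 / 3 * step_A (Suc j) * \<delta>g = 4 / 3 * step_A j * \<delta>g + 4 / 3 * a j * \<delta>g"
    by (simp add: step_A_Suc algebra_simps)
  moreover have "expectation (potential j) \<le> 4 / 3 * step_A j * \<delta>g
    + (c1 * Var B \<Xi> g gbar xstar / \<mu>) * (real j * (real j + 1) * (2 * real j + 1) / 4)
    + c3 * \<delta>f * (real j * (real j + 1) * (real j + 2) / 12)
    + c4 * D\<^sup>2 * expectation (\<lambda>\<omega>. min (M j \<omega>) C)"
    using Suc by simp
  ultimately show ?case
    using step unfolding sq cu right_diff_distrib by argo
qed

section \<open>The rate, first with a free excess \<nu> and then optimised\<close>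

lemma rate_parametric:
  assumes D: "0 < D" and k: "1 \<le> k" and \<nu>: "0 < \<nu>"
  shows "expectation (\<lambda>\<omega>. F (x k \<omega>)) - F xstar
    \<le> 4 * c2 * c4 * Lf * D\<^sup>2 / (real k * (real k + 1)) + 24 * c1 * c4 * Lg * D\<^sup>2 / (real k + 1)
      + c3 / 3 * (real k + 2) * \<delta>f + 4 / 3 * \<delta>g
      + (c1 * Var B \<Xi> g gbar xstar * (2 * real k + 1) / \<nu> + 4 * c4 * D\<^sup>2 / (real k * (real k + 1)) * \<nu>)"
proof -
  \<comment> \<open>The first summand is the least value allowed for all steps up to
    \<open>k\<close> and leads to the term with 24 = 4 * 6; \<nu> stays free. Below, \<mu> is
    weakened to \<nu> in the variance denominator, leaving the shape
    \<open>p / \<nu> + q * \<nu>\<close>.\<close>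
  define \<mu> where "\<mu> = 6 * c1 * Lg * real k + \<nu>"
  define C where "C = c2 * Lf + \<mu>"
  define s where "s = Var B \<Xi> g gbar xstar"
  define n where "n = real k"
  have n: "1 \<le> n" using k by (simp add: n_def)
  have A: "step_A k = n * (n + 1) / 4" by (simp add: step_A_eq n_def)
  have A_pos: "0 < step_A k" using n by (simp add: A)
  have \<mu>: "\<nu> \<le> \<mu>" using c Lg by (simp add: \<mu>_def)
  have s: "0 \<le> s" by (simp add: s_def Var_nonneg)
  let ?G = "expectation (\<lambda>\<omega>. F (x k \<omega>)) - F xstar"
  have "step_A k * ?G = expectation (\<lambda>\<omega>. step_A k * (F (x k \<omega>) - F xstar))"
    using F_integrable[OF D, of k] by (simp add: prob_space)
  also have "\<dots> \<le> expectation (potential k)"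
    using F_integrable[OF D, of k] M_nonneg[OF D]
    by (intro integral_mono potential_integrable D) (auto simp: potential_def)
  also have "\<dots> \<le> 4 / 3 * step_A k * \<delta>g + (c1 * s / \<mu>) * (n * (n + 1) * (2 * n + 1) / 4)
    + c3 * \<delta>f * (n * (n + 1) * (n + 2) / 12) + c4 * D\<^sup>2 * expectation (\<lambda>\<omega>. min (M k \<omega>) C)"
    unfolding s_def n_def C_def
  proof (rule expected_potential[OF D _ _ order_refl])
    show "0 < \<mu>" using \<nu> \<mu> by linarith
    show "6 * c1 * Lg * real k \<le> \<mu>" using \<nu> by (simp add: \<mu>_def)
  qed
  also have "\<dots> \<le> 4 / 3 * step_A k * \<delta>g + (c1 * s / \<nu>) * (n * (n + 1) * (2 * n + 1) / 4)
    + c3 * \<delta>f * (n * (n + 1) * (n + 2) / 12) + c4 * D\<^sup>2 * C"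
  proof -
    have "expectation (\<lambda>\<omega>. min (M k \<omega>) C) \<le> expectation (\<lambda>_. C)"
      by (intro integral_mono min_M_integrable[OF D]) auto
    then have "c4 * D\<^sup>2 * expectation (\<lambda>\<omega>. min (M k \<omega>) C) \<le> c4 * D\<^sup>2 * C"
      using c by (intro mult_left_mono) (auto simp: prob_space)
    moreover have "c1 * s / \<mu> * (n * (n + 1) * (2 * n + 1) / 4) \<le> c1 * s / \<nu> * (n * (n + 1) * (2 * n + 1) / 4)"
      using \<mu> \<nu> s c n by (intro mult_right_mono divide_left_mono) auto
    ultimately show ?thesis by linarith
  qed
  also have "\<dots> = step_A k * (4 / 3 * \<delta>g + c1 * s * (2 * n + 1) / \<nu> + c3 / 3 * (n + 2) * \<delta>f
      + 4 * c4 * D\<^sup>2 * C / (n * (n + 1)))"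
    using n \<nu> by (simp add: A divide_simps) (simp add: algebra_simps)
  finally have "?G \<le> 4 / 3 * \<delta>g + c1 * s * (2 * n + 1) / \<nu> + c3 / 3 * (n + 2) * \<delta>f
      + 4 * c4 * D\<^sup>2 * C / (n * (n + 1))"
    using A_pos by simp
  moreover have "4 * c4 * D\<^sup>2 * C / (n * (n + 1)) = 4 * c2 * c4 * Lf * D\<^sup>2 / (n * (n + 1))
      + 24 * c1 * c4 * Lg * D\<^sup>2 / (n + 1) + 4 * c4 * D\<^sup>2 / (n * (n + 1)) * \<nu>"
    using n by (simp add: C_def \<mu>_def n_def[symmetric] divide_simps) (simp add: algebra_simps)
  ultimately show ?thesis by (simp add: s_def n_def)
qed

lemma rate:
  assumes D: "0 < D" and k: "1 \<le> k"
  shows "expectation (\<lambda>\<omega>. F (x k \<omega>)) - F xstar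
    \<le> 4 * c2 * c4 * Lf * D\<^sup>2 / (real k * (real k + 1)) + 24 * c1 * c4 * Lg * D\<^sup>2 / (real k + 1)
      + 4 * sqrt (Var B \<Xi> g gbar xstar) * D * sqrt (2 * c1 * c4 / real k)
      + c3 / 3 * (real k + 2) * \<delta>f + 4 / 3 * \<delta>g"
proof -
  define s where "s = Var B \<Xi> g gbar xstar"
  define n where "n = real k"
  define R where "R = 4 * c2 * c4 * Lf * D\<^sup>2 / (n * (n + 1)) + 24 * c1 * c4 * Lg * D\<^sup>2 / (n + 1)
      + c3 / 3 * (n + 2) * \<delta>f + 4 / 3 * \<delta>g"
  define p where "p = c1 * s * (2 * n + 1)"
  define q where "q = 4 * c4 * D\<^sup>2 / (n * (n + 1))"
  have n: "1 \<le> n" using k by (simp add: n_def)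
  have s: "0 \<le> s" by (simp add: s_def Var_nonneg)
  have "expectation (\<lambda>\<omega>. F (x k \<omega>)) - F xstar - R \<le> 2 * sqrt (p * q)"
  proof (rule le_optimal_tradeoff)
    show "0 \<le> p" using c s n by (simp add: p_def)
    show "0 < q" using c D n by (simp add: q_def)
    show "expectation (\<lambda>\<omega>. F (x k \<omega>)) - F xstar - R \<le> p / \<nu> + q * \<nu>" if "0 < \<nu>" for \<nu>
      using rate_parametric[OF D k that] by (simp add: R_def p_def q_def s_def n_def)
  qed
  also have "sqrt (p * q) \<le> 2 * sqrt s * D * sqrt (2 * c1 * c4 / n)"
  proof (rule real_le_lsqrt)
    \<comment> \<open>This fraction is what remains in \<open>p * q\<close> after the factor
      \<open>4 * c1 * c4 * s * D\<^sup>2 / n\<close>; replacing it by 2 puts the 2 under the square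
      root of the theorem.\<close>
    have "(2 * n + 1) / (n + 1) \<le> 2" using n by (simp add: pos_divide_le_eq)
    then have "4 * c1 * c4 * s * D\<^sup>2 / n * ((2 * n + 1) / (n + 1)) \<le> 4 * c1 * c4 * s * D\<^sup>2 / n * 2"
      using c s n by (intro mult_left_mono) auto
    also have "\<dots> = (2 * sqrt s * D * sqrt (2 * c1 * c4 / n))\<^sup>2"
      using c s n by (simp add: power_mult_distrib)
    finally show "p * q \<le> (2 * sqrt s * D * sqrt (2 * c1 * c4 / n))\<^sup>2"
      by (simp add: p_def q_def mult_ac)
    show "0 \<le> 2 * sqrt s * D * sqrt (2 * c1 * c4 / n)" using c s n D by simp
  qed
  finally show ?thesis by (simp add: R_def s_def n_def)
qed

lemma rate_degenerate:
  assumes D: "D = 0" and \<omega>: "\<omega> \<in> space P"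
  shows "F (x k \<omega>) = F xstar"
  using dist_le_D[OF x_dom[OF \<omega>, of k] xstar_dom] primal_norm_pos[OF B, of "x k \<omega> - xstar"] D
  by fastforce

lemma convergence:
  assumes k: "1 \<le> k"
  shows "integrable P (\<lambda>\<omega>. real_of_ereal (objective f \<psi> (x k \<omega>))) \<and>
    (\<integral>\<omega>. real_of_ereal (objective f \<psi> (x k \<omega>)) \<partial>P) - real_of_ereal (optimal_value f \<psi>)
      \<le> 4 * c2 * c4 * Lf * D\<^sup>2 / (real k * (real k + 1))
        + 24 * c1 * c4 * Lg * D\<^sup>2 / (real k + 1)
        + 4 * sqrt (Var B \<Xi> g gbar xstar) * D * sqrt (2 * c1 * c4 / real k)
        + c3 / 3 * (real k + 2) * \<delta>f
        + 4 / 3 * \<delta>g" (is "integrable P ?G \<and> _ \<le> ?R")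
proof -
  have G: "?G \<omega> = F (x k \<omega>)" if "\<omega> \<in> space P" for \<omega>
    using objective_eq[OF x_dom[OF that]] by simp
  have int: "integrable P (\<lambda>\<omega>. F (x k \<omega>)) \<and> expectation (\<lambda>\<omega>. F (x k \<omega>)) - F xstar \<le> ?R"
  proof (cases "D = 0")
    case True
    have "integrable P (\<lambda>\<omega>. F (x k \<omega>)) \<longleftrightarrow> integrable P (\<lambda>_. F xstar)"
      by (intro Bochner_Integration.integrable_cong refl rate_degenerate True)
    moreover have "expectation (\<lambda>\<omega>. F (x k \<omega>)) = expectation (\<lambda>_. F xstar)"
      by (intro Bochner_Integration.integral_cong refl rate_degenerate True)
    ultimately show ?thesis using True c \<delta>f_nonneg \<delta>g by (simp add: prob_space)
  next
    case False
    then have "0 < D" using D_nonneg by simp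
    then show ?thesis using F_integrable rate k by blast
  qed
  moreover have "integrable P ?G \<longleftrightarrow> integrable P (\<lambda>\<omega>. F (x k \<omega>))"
    by (intro Bochner_Integration.integrable_cong refl G)
  moreover have "expectation ?G = expectation (\<lambda>\<omega>. F (x k \<omega>))"
    by (intro Bochner_Integration.integral_cong refl G)
  ultimately show ?thesis by (simp add: optimal_value_eq)
qed

end

theorem theorem8:
  fixes P :: "'w measure" and \<Xi> :: "'s measure"
    and B :: "real ^ 'n ^ 'n"
    and f fbar :: "real ^ 'n \<Rightarrow> real" and gbar :: "real ^ 'n \<Rightarrow> real ^ 'n"
    and \<psi> :: "real ^ 'n \<Rightarrow> ereal"
    and g :: "real ^ 'n \<Rightarrow> 's \<Rightarrow> real ^ 'n"
    and Mplus :: "real \<Rightarrow> real \<Rightarrow> real ^ 'n \<Rightarrow> real ^ 'n \<Rightarrow> real ^ 'n \<Rightarrow> real ^ 'n \<Rightarrow> real"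
    and x v y :: "nat \<Rightarrow> 'w \<Rightarrow> real ^ 'n" and M :: "nat \<Rightarrow> 'w \<Rightarrow> real"
    and H :: "nat \<Rightarrow> 'w measure" and \<zeta> :: "nat \<Rightarrow> 'w \<Rightarrow> 's"
    and x0 xstar :: "real ^ 'n"
    and D \<delta>f Lf \<delta>g Lg c1 c2 c3 c4 \<sigma> :: real and k :: nat
  assumes "prob_space P"
    and "positive_definite B"
    and "convex_on UNIV f" and "proper_closed_convex \<psi>"
    and "is_solution f \<psi> xstar"
    and "approx_smooth B f fbar gbar \<delta>f Lf" and "fbar \<in> borel_measurable borel"
    and "\<forall>x\<in>eff_dom \<psi>. \<forall>y\<in>eff_dom \<psi>. primal_norm B (x - y) \<le> D"
    and "stochastic_oracle \<Xi> g" and "unbiased_oracle \<Xi> g gbar" and "finite_variance B \<Xi> g gbar"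
    and "0 \<le> \<delta>g" and "0 \<le> Lg"
    and "\<forall>x y. Var2 B \<Xi> g gbar x y \<le> 2 * Lg * (lin_error f fbar gbar x y + \<delta>g)"
    and "\<sigma> = sqrt (Var B \<Xi> g gbar xstar)"
    and "0 < c1" and "0 < c2" and "0 < c3" and "0 < c4"
    and "stepsize_requirement P \<Xi> g B f fbar gbar \<psi> \<delta>f Lf c1 c2 c3 c4 Mplus"
    and "x0 \<in> eff_dom \<psi>"
    and "universal_fast_sgd P \<Xi> g B \<psi> D Mplus x0 H \<zeta> x v y M"
    and "1 \<le> k"
  shows "integrable P (\<lambda>\<omega>. real_of_ereal (objective f \<psi> (x k \<omega>))) \<and>
    (\<integral>\<omega>. real_of_ereal (objective f \<psi> (x k \<omega>)) \<partial>P) - real_of_ereal (optimal_value f \<psi>)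
      \<le> 4 * c2 * c4 * Lf * D\<^sup>2 / (real k * (real k + 1))
        + 24 * c1 * c4 * Lg * D\<^sup>2 / (real k + 1)
        + 4 * \<sigma> * D * sqrt (2 * c1 * c4 / real k)
        + c3 / 3 * (real k + 2) * \<delta>f
        + 4 / 3 * \<delta>g"
proof -
  interpret fast_sgd_run P \<Xi> B f fbar gbar \<psi> g Mplus x v y M H \<zeta> x0 xstar D \<delta>f Lf \<delta>g Lg c1 c2 c3 c4
    by (rule fast_sgd_run.intro) (fact assms)+
  show ?thesis using convergence[OF \<open>1 \<le> k\<close>] assms by simp
qed

end
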